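(* Let $n\ge 1$. The fixed-point algebra $\mathcal{O}_{2n}^{\lambda_E}=\{x\in\mathcal{O}_{2n}:\lambda_E(x)=x\}$ of $\mathcal{O}_{2n}$ under the exchange automorphism $\lambda_E$ is generated (as a $C^*$-algebra) by the elements $$y_l^j:=(2n)^{-1/2}\,\mathrm{Ad}(\tilde v^l)\big(\tilde v^{2j}T\big)=(2n)^{-1/2}\,\tilde v^l\,\tilde v^{2j}\,T\,(\tilde v^l)^*,\qquad j=0,\ldots,n-1,\ l=0,\ldots,2n-1,$$ where $$T=\frac{1}{\sqrt{2n}}\sum_{k=1}^{2n}S_k,\qquad \tilde v=\sum_{k=1}^n e^{2\pi k i/(2n)}S_kS_k^*+\sum_{k=1}^n e^{2\pi(k+n)i/(2n)}S_{2n-k+1}S_{2n-k+1}^*.$$ Moreover, for any fixed $j\in\{0,\ldots,n-1\}$, the $C^*$-algebra $C^*(\{y_l^j\}_{l=0}^{2n-1})$ is $*$-isomorphic with $\mathcal{O}_{2n}$.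
   Context: $\mathcal{O}_{2n}$ is the Cuntz algebra: the universal $C^*$-algebra generated by $2n$ isometries $S_1,\ldots,S_{2n}$ such that $\sum_{k=1}^{2n}S_kS_k^*=1$. The exchange automorphism $\lambda_E$ of $\mathcal{O}_{2n}$ is the $*$-automorphism (of order $2$) determined by $\lambda_E(S_k)=S_{2n-k+1}$ for $k=1,\ldots,2n$. In the exponentials, $i$ is the imaginary unit. *)

theory Defs
  imports "HOL-Analysis.Analysis" "HOL-Algebra.Ring"
begin

section \<open>Unital $C^*$-algebras as types\<close>

text \<open>
  Nonzero unital $C^*$-algebras whose carrier is a whole type (the sort \<open>real_normed_algebra_1\<close>
  forces \<open>norm 1 = 1\<close>).  The ambient Cuntz algebra lives in such a type, its subalgebras are sets.
\<close>

class cstar_algebra = real_normed_algebra_1 + banach +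
  fixes scaleC :: "complex \<Rightarrow> 'a \<Rightarrow> 'a"  (infixr \<open>*\<^sub>C\<close> 75)
    and adj :: "'a \<Rightarrow> 'a"
  assumes scaleC_add_right: "c *\<^sub>C (x + y) = c *\<^sub>C x + c *\<^sub>C y"
    and scaleC_add_left: "(c + d) *\<^sub>C x = c *\<^sub>C x + d *\<^sub>C x"
    and scaleC_scaleC: "c *\<^sub>C d *\<^sub>C x = (c * d) *\<^sub>C x"
    and scaleR_scaleC: "r *\<^sub>R x = complex_of_real r *\<^sub>C x"
    and mult_scaleC_left: "(c *\<^sub>C x) * y = c *\<^sub>C (x * y)"
    and mult_scaleC_right: "x * (c *\<^sub>C y) = c *\<^sub>C (x * y)"
    and norm_scaleC: "norm (c *\<^sub>C x) = cmod c * norm x"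
    and adj_add: "adj (x + y) = adj x + adj y"
    and adj_scaleC: "adj (c *\<^sub>C x) = cnj c *\<^sub>C adj x"
    and adj_mult: "adj (x * y) = adj y * adj x"
    and adj_adj: "adj (adj x) = x"
    and cstar_identity: "norm (adj x * x) = (norm x)\<^sup>2"

lemma scaleC_one: "1 *\<^sub>C x = (x :: 'a::cstar_algebra)"
  using scaleR_scaleC[of 1 x, symmetric] by simp

lemma scaleC_zero_right: "c *\<^sub>C (0 :: 'a::cstar_algebra) = 0"
  using scaleC_add_right[of c "0 :: 'a" 0] by simp

lemma adj_zero: "adj (0 :: 'a::cstar_algebra) = 0"
  using adj_add[of "0 :: 'a" 0] by simp

definition star_subalgebra :: "'a::cstar_algebra set \<Rightarrow> bool" where
  "star_subalgebra A \<longleftrightarrow>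
     0 \<in> A \<and> (\<forall>x\<in>A. \<forall>y\<in>A. x + y \<in> A \<and> x * y \<in> A) \<and>
     (\<forall>c. \<forall>x\<in>A. c *\<^sub>C x \<in> A) \<and> (\<forall>x\<in>A. adj x \<in> A)"

definition cstar_subalgebra :: "'a::cstar_algebra set \<Rightarrow> bool" where
  "cstar_subalgebra A \<longleftrightarrow> star_subalgebra A \<and> closed A"

text \<open>\<open>cstar_generated X\<close> is $C^*(X)$; the unit of the ambient algebra is not added to \<open>X\<close>.\<close>

definition cstar_generated :: "'a::cstar_algebra set \<Rightarrow> 'a set" where
  "cstar_generated X = cstar_subalgebra hull X"

lemma cstar_subalgebra_cstar_generated: "cstar_subalgebra (cstar_generated X)"
  unfolding cstar_generated_def
  by (rule hull_in) (auto simp: cstar_subalgebra_def star_subalgebra_def)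


section \<open>$C^*$-algebras as structures\<close>

text \<open>
  HOL cannot quantify over types inside a formula, so the universal property of the Cuntz algebra
  needs $C^*$-algebras as structures with an explicit carrier.
\<close>

record 'a cstar_structure = "'a ring" +
  scal :: "complex \<Rightarrow> 'a \<Rightarrow> 'a"
  invol :: "'a \<Rightarrow> 'a"
  nrm :: "'a \<Rightarrow> real"

locale unital_cstar_algebra = ring B for B (structure) +
  assumes scal_closed: "x \<in> carrier B \<Longrightarrow> scal B c x \<in> carrier B"
    and scal_add_right:
      "\<lbrakk>x \<in> carrier B; y \<in> carrier B\<rbrakk> \<Longrightarrow> scal B c (x \<oplus> y) = scal B c x \<oplus> scal B c y"
    and scal_add_left: "x \<in> carrier B \<Longrightarrow> scal B (c + d) x = scal B c x \<oplus> scal B d x"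
    and scal_scal: "x \<in> carrier B \<Longrightarrow> scal B c (scal B d x) = scal B (c * d) x"
    and scal_one: "x \<in> carrier B \<Longrightarrow> scal B 1 x = x"
    and mult_scal_left:
      "\<lbrakk>x \<in> carrier B; y \<in> carrier B\<rbrakk> \<Longrightarrow> scal B c x \<otimes> y = scal B c (x \<otimes> y)"
    and mult_scal_right:
      "\<lbrakk>x \<in> carrier B; y \<in> carrier B\<rbrakk> \<Longrightarrow> x \<otimes> scal B c y = scal B c (x \<otimes> y)"
    and invol_closed: "x \<in> carrier B \<Longrightarrow> invol B x \<in> carrier B"
    and invol_add:
      "\<lbrakk>x \<in> carrier B; y \<in> carrier B\<rbrakk> \<Longrightarrow> invol B (x \<oplus> y) = invol B x \<oplus> invol B y"
    and invol_scal: "x \<in> carrier B \<Longrightarrow> invol B (scal B c x) = scal B (cnj c) (invol B x)"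
    and invol_mult:
      "\<lbrakk>x \<in> carrier B; y \<in> carrier B\<rbrakk> \<Longrightarrow> invol B (x \<otimes> y) = invol B y \<otimes> invol B x"
    and invol_invol: "x \<in> carrier B \<Longrightarrow> invol B (invol B x) = x"
    and nrm_eq_zero: "x \<in> carrier B \<Longrightarrow> nrm B x = 0 \<longleftrightarrow> x = \<zero>"
    and nrm_triangle:
      "\<lbrakk>x \<in> carrier B; y \<in> carrier B\<rbrakk> \<Longrightarrow> nrm B (x \<oplus> y) \<le> nrm B x + nrm B y"
    and nrm_scal: "x \<in> carrier B \<Longrightarrow> nrm B (scal B c x) = cmod c * nrm B x"
    and nrm_mult:
      "\<lbrakk>x \<in> carrier B; y \<in> carrier B\<rbrakk> \<Longrightarrow> nrm B (x \<otimes> y) \<le> nrm B x * nrm B y"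
    and nrm_cstar: "x \<in> carrier B \<Longrightarrow> nrm B (invol B x \<otimes> x) = (nrm B x)\<^sup>2"
    and nrm_complete:
      "\<lbrakk>range f \<subseteq> carrier B; \<And>e. e > 0 \<Longrightarrow> \<exists>N. \<forall>m\<ge>N. \<forall>k\<ge>N. nrm B (f m \<ominus> f k) < e\<rbrakk>
        \<Longrightarrow> \<exists>x\<in>carrier B. (\<lambda>k. nrm B (f k \<ominus> x)) \<longlonglongrightarrow> (0::real)"

definition star_hom ::
  "'a cstar_structure \<Rightarrow> 'b cstar_structure \<Rightarrow> ('a \<Rightarrow> 'b) \<Rightarrow> bool" where
  "star_hom A B \<phi> \<longleftrightarrow>
     \<phi> \<in> carrier A \<rightarrow> carrier B \<and>
     (\<forall>x\<in>carrier A. \<forall>y\<in>carrier A. \<phi> (x \<oplus>\<^bsub>A\<^esub> y) = \<phi> x \<oplus>\<^bsub>B\<^esub> \<phi> y \<and>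
                                    \<phi> (x \<otimes>\<^bsub>A\<^esub> y) = \<phi> x \<otimes>\<^bsub>B\<^esub> \<phi> y) \<and>
     (\<forall>c. \<forall>x\<in>carrier A. \<phi> (scal A c x) = scal B c (\<phi> x)) \<and>
     (\<forall>x\<in>carrier A. \<phi> (invol A x) = invol B (\<phi> x))"

definition star_iso ::
  "'a cstar_structure \<Rightarrow> 'b cstar_structure \<Rightarrow> ('a \<Rightarrow> 'b) \<Rightarrow> bool" where
  "star_iso A B \<phi> \<longleftrightarrow> star_hom A B \<phi> \<and> bij_betw \<phi> (carrier A) (carrier B)"

definition star_isomorphic :: "'a cstar_structure \<Rightarrow> 'b cstar_structure \<Rightarrow> bool" where
  "star_isomorphic A B \<longleftrightarrow> (\<exists>\<phi>. star_iso A B \<phi>)"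

text \<open>
  The structure on a subset \<open>A\<close> of the ambient algebra.  When \<open>A\<close> does not contain \<open>1\<close>
  the field \<open>one\<close> is meaningless; \<open>star_hom\<close> does not refer to it.
\<close>

definition cstar_on :: "'a::cstar_algebra set \<Rightarrow> 'a cstar_structure" where
  "cstar_on A =
     \<lparr>carrier = A, mult = (*), one = 1, zero = 0, add = (+),
      scal = (*\<^sub>C), invol = adj, nrm = norm\<rparr>"

lemma cstar_on_simps [simp]:
  "carrier (cstar_on A) = A"
  "mult (cstar_on A) = (*)"
  "one (cstar_on A) = 1"
  "zero (cstar_on A) = 0"
  "add (cstar_on A) = (+)"
  "scal (cstar_on A) = (*\<^sub>C)"
  "invol (cstar_on A) = adj"
  "nrm (cstar_on A) = norm"
  by (simp_all add: cstar_on_def)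

lemma uminus_in_star_subalgebra:
  assumes "star_subalgebra A" "x \<in> A"
  shows "- x \<in> A"
proof -
  have "- x = (-1) *\<^sub>C x"
    using scaleR_scaleC[of "-1" x] by simp
  then show ?thesis using assms by (simp add: star_subalgebra_def)
qed

lemma ring_cstar_on:
  assumes "star_subalgebra A" "1 \<in> A"
  shows "ring (cstar_on A)"
proof (rule ringI)
  show "abelian_group (cstar_on A)"
  proof (rule abelian_groupI)
    fix x assume "x \<in> carrier (cstar_on A)"
    then show "\<exists>y\<in>carrier (cstar_on A). y \<oplus>\<^bsub>cstar_on A\<^esub> x = \<zero>\<^bsub>cstar_on A\<^esub>"
      using uminus_in_star_subalgebra[OF assms(1), of x] by (auto intro!: bexI[of _ "- x"])
  qed (use assms in \<open>auto simp: star_subalgebra_def algebra_simps\<close>)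
  show "monoid (cstar_on A)"
    by (rule monoidI) (use assms in \<open>auto simp: star_subalgebra_def algebra_simps\<close>)
qed (use assms in \<open>auto simp: star_subalgebra_def algebra_simps\<close>)

lemma minus_cstar_on:
  assumes "star_subalgebra A" "1 \<in> A" "x \<in> A" "y \<in> A"
  shows "x \<ominus>\<^bsub>cstar_on A\<^esub> y = x - y"
proof -
  interpret ring "cstar_on A" using ring_cstar_on assms by blast
  have "\<ominus>\<^bsub>cstar_on A\<^esub> y = - y"
    by (rule minus_equality) (use assms uminus_in_star_subalgebra in auto)
  then show ?thesis by (simp add: a_minus_def)
qed

lemma unital_cstar_algebra_cstar_on:
  assumes "cstar_subalgebra A" "1 \<in> A"
  shows "unital_cstar_algebra (cstar_on A)"
proof -
  have A: "star_subalgebra A" "closed A"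
    using assms by (auto simp: cstar_subalgebra_def)
  interpret ring "cstar_on A" using ring_cstar_on A assms by blast
  show ?thesis
  proof (unfold_locales, goal_cases)
    case (18 f)
    have f: "f k \<in> A" for k using 18 by auto
    have "Cauchy f"
      unfolding Cauchy_iff using 18(2) minus_cstar_on[OF A(1) assms(2)] f by simp
    then obtain x where x: "f \<longlonglongrightarrow> x"
      using Cauchy_convergent convergent_def by blast
    then have "x \<in> A" using A(2) f closed_sequentially by blast
    moreover have "(\<lambda>k. norm (f k - x)) \<longlonglongrightarrow> 0"
      using x by (simp add: LIM_zero_iff tendsto_norm_zero_iff)
    ultimately show ?case
      using minus_cstar_on[OF A(1) assms(2)] f by auto
  qed (use A assms in \<open>auto simp: star_subalgebra_def scaleC_add_right scaleC_add_left
      scaleC_scaleC scaleC_one mult_scaleC_left mult_scaleC_right norm_scaleC adj_add adj_scaleC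
      adj_mult adj_adj cstar_identity norm_triangle_ineq norm_mult_ineq\<close>)
qed

abbreviation cstar_whole :: "'a::cstar_algebra cstar_structure" where
  "cstar_whole \<equiv> cstar_on UNIV"

lemma unital_cstar_algebra_cstar_whole: "unital_cstar_algebra cstar_whole"
  by (rule unital_cstar_algebra_cstar_on) (auto simp: cstar_subalgebra_def star_subalgebra_def)


section \<open>The Cuntz algebra\<close>

definition cuntz_isometries :: "'a cstar_structure \<Rightarrow> nat \<Rightarrow> (nat \<Rightarrow> 'a) \<Rightarrow> bool" where
  "cuntz_isometries B m T \<longleftrightarrow>
     (\<forall>k\<in>{1..m}. T k \<in> carrier B \<and> invol B (T k) \<otimes>\<^bsub>B\<^esub> T k = \<one>\<^bsub>B\<^esub>) \<and>
     (\<Oplus>\<^bsub>B\<^esub>k\<in>{1..m}. T k \<otimes>\<^bsub>B\<^esub> invol B (T k)) = \<one>\<^bsub>B\<^esub>"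

lemma finsum_cstar_whole:
  fixes f :: "'i \<Rightarrow> 'a::cstar_algebra"
  assumes "finite I"
  shows "(\<Oplus>\<^bsub>cstar_whole\<^esub>i\<in>I. f i) = (\<Sum>i\<in>I. f i)"
proof -
  interpret unital_cstar_algebra "cstar_whole :: 'a cstar_structure"
    by (rule unital_cstar_algebra_cstar_whole)
  from assms show ?thesis
    by induction auto
qed

lemma cuntz_isometries_cstar_whole:
  "cuntz_isometries cstar_whole m S \<longleftrightarrow>
     (\<forall>k\<in>{1..m}. adj (S k) * S k = 1) \<and> (\<Sum>k=1..m. S k * adj (S k)) = 1"
  by (simp add: cuntz_isometries_def finsum_cstar_whole)

text \<open>
  \<open>cuntz_algebra m S\<close>: the type \<open>'a\<close>, with generators \<open>S 1, \<dots>, S m\<close>, is the universal unital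
  $C^*$-algebra generated by \<open>m\<close> isometries with range projections summing to \<open>1\<close>.

  The target algebras \<open>B\<close> range over all $C^*$-algebras whose carrier is a subset of \<open>'a\<close>, with
  arbitrary operations and norm.  This loses no generality: replacing a target by the
  $C^*$-subalgebra generated by the \<open>T k\<close>, one may take it separable, hence of cardinality at
  most that of the continuum, and \<open>'a\<close> contains a copy of the complex numbers, so
  an isomorphic copy of the target has its carrier inside \<open>'a\<close>.  The homomorphism \<open>\<phi>\<close> is
  automatically unital, by the relations, and unique, because the \<open>S k\<close> generate.
\<close>

definition cuntz_algebra :: "nat \<Rightarrow> (nat \<Rightarrow> 'a::cstar_algebra) \<Rightarrow> bool" where
  "cuntz_algebra m S \<longleftrightarrow>
     cuntz_isometries cstar_whole m S \<and>
     cstar_generated (S ` {1..m}) = UNIV \<and>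
     (\<forall>(B :: 'a cstar_structure) T. unital_cstar_algebra B \<and> cuntz_isometries B m T \<longrightarrow>
        (\<exists>\<phi>. star_hom cstar_whole B \<phi> \<and> (\<forall>k\<in>{1..m}. \<phi> (S k) = T k)))"

definition exchange_automorphism ::
  "nat \<Rightarrow> (nat \<Rightarrow> 'a::cstar_algebra) \<Rightarrow> ('a \<Rightarrow> 'a) \<Rightarrow> bool" where
  "exchange_automorphism n S lam \<longleftrightarrow>
     star_iso cstar_whole cstar_whole lam \<and> (\<forall>k\<in>{1..2*n}. lam (S k) = S (2*n - k + 1))"

definition Ad :: "'a::cstar_algebra \<Rightarrow> 'a \<Rightarrow> 'a" where
  "Ad u x = u * x * adj u"

definition T_elem :: "nat \<Rightarrow> (nat \<Rightarrow> 'a::cstar_algebra) \<Rightarrow> 'a" where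
  "T_elem n S = (1 / sqrt (real (2*n))) *\<^sub>R (\<Sum>k=1..2*n. S k)"

definition v_tilde :: "nat \<Rightarrow> (nat \<Rightarrow> 'a::cstar_algebra) \<Rightarrow> 'a" where
  "v_tilde n S =
     (\<Sum>k=1..n. exp (2 * pi * k * \<i> / (2 * n)) *\<^sub>C (S k * adj (S k))) +
     (\<Sum>k=1..n. exp (2 * pi * (k + n) * \<i> / (2 * n)) *\<^sub>C
        (S (2*n - k + 1) * adj (S (2*n - k + 1))))"

definition y_elem :: "nat \<Rightarrow> (nat \<Rightarrow> 'a::cstar_algebra) \<Rightarrow> nat \<Rightarrow> nat \<Rightarrow> 'a" where
  "y_elem n S j l =
     (real (2*n) powr (-1/2)) *\<^sub>R Ad (v_tilde n S ^ l) (v_tilde n S ^ (2*j) * T_elem n S)"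

end

theory Submission
  imports Defs
begin

text \<open>
  Put \<open>m = 2n\<close> and let \<open>z\<close> be the primitive \<open>m\<close>-th root of unity in the definition of
  \<open>v_tilde\<close>.  Relabel the generators as \<open>t q\<close>, with \<open>q\<close> modulo \<open>m\<close>, so that the unitary
  \<open>v = v_tilde\<close> has eigenvalue \<open>z ^ q\<close> on the range of \<open>t q\<close>.  In this labelling the
  exchange automorphism is the half turn \<open>t q \<mapsto> t (q + n)\<close>, so it sends \<open>v\<close> to \<open>- v\<close>, while
  \<open>T = W 0\<close> and \<open>v ^ l * T = W l\<close>, where \<open>W\<close> is the discrete Fourier transform of \<open>t\<close>.  The \<open>W l\<close>
  are again Cuntz isometries that generate the algebra.  Up to the scalar \<open>(2n) powr (- 1/2)\<close>
  the element \<open>y_elem n S j l\<close> is \<open>Y j l = W (l + 2 * j) * adj (v ^ l)\<close>.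

  The fixed-point algebra.  Every \<open>Y j l\<close> is fixed, being even in \<open>v\<close>.  Let \<open>A\<close> be the algebra
  generated by all of them.  It contains \<open>v * v = adj (Y 0 2) * Y 1 0\<close>, and conjugation by \<open>v\<close>
  maps \<open>Y j l\<close> to \<open>Y j (l + 1)\<close> and hence \<open>A\<close> into itself.  Therefore \<open>A + A * v\<close> is a
  *-subalgebra.  It contains \<open>W (2 * j) = Y j 0\<close> and \<open>W (2 * j + 1) = Y j 1 * v\<close>, so it is
  everything once it is known to be closed, and it is closed because both summands are recovered
  from \<open>x\<close> continuously, through \<open>x + lam x\<close> and \<open>x - lam x\<close> (\<open>A_plus_Av\<close>).  As the exchange acts
  as \<open>1\<close> on \<open>A\<close> and as \<open>- 1\<close> on \<open>A * v\<close>, its fixed points are exactly \<open>A\<close>.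

  The isomorphism.  For fixed \<open>j\<close> the \<open>Y j l\<close> are Cuntz isometries, so universality gives a
  *-homomorphism \<open>\<phi>\<close> with \<open>\<phi> (t l) = Y j l\<close>, and the point is that \<open>\<phi>\<close> is isometric.  Simplicity
  of the Cuntz algebra would do; here a left inverse is written down instead.  The elements
  \<open>D l = (\<Sum>i<m. t i * t (i + l) * adj (t i))\<close> are block diagonal copies of the generators, the
  block at \<open>0\<close> being \<open>t l\<close> itself, and they are permuted by conjugation with the cyclic shift
  \<open>U = (\<Sum>i<m. t i * adj (t (i + 1)))\<close> just as the \<open>Y j l\<close> are permuted by \<open>v\<close>.  The elements
  \<open>U ^ k * D 0\<close> turn out to be Cuntz isometries, so universality gives a second *-homomorphism \<open>\<psi>\<close>,
  sending \<open>v\<close> to \<open>U\<close> and \<open>Y j l\<close> to \<open>D l\<close>.  Cutting down to the block at \<open>0\<close> gives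
  \<open>x = adj (t 0) * \<psi> (\<phi> x) * t 0\<close>, so \<open>norm x \<le> norm (\<phi> x)\<close>
  (\<open>star_isomorphic_generated_Y\<close>).

  Two general facts on $C^*$-algebras are used.  A *-homomorphism is contractive
  (\<open>star_hom_contractive\<close>): a self-adjoint element of norm below \<open>1\<close> is the real part of a unitary.
  Isometries with range projections summing to \<open>1\<close> have orthogonal ranges
  (\<open>cuntz_isometries_orthogonal\<close>); the usual appeal to positivity is replaced by the fact that
  \<open>1\<close> is an extreme point among the self-adjoint elements of the unit ball (\<open>one_is_extreme\<close>).
\<close>

section \<open>Elementary identities and norm bounds\<close>

lemma scaleC_zero_left: "0 *\<^sub>C (x :: 'a::cstar_algebra) = 0"
  using scaleR_scaleC[of 0 x, symmetric] by simp

lemma scaleC_sum_right: "c *\<^sub>C (\<Sum>i\<in>I. f i) = (\<Sum>i\<in>I. c *\<^sub>C (f i :: 'a::cstar_algebra))"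
  by (induction I rule: infinite_finite_induct) (auto simp: scaleC_zero_right scaleC_add_right)

lemma scaleC_sum_left: "(\<Sum>i\<in>I. c i) *\<^sub>C x = (\<Sum>i\<in>I. c i *\<^sub>C (x :: 'a::cstar_algebra))"
  by (induction I rule: infinite_finite_induct) (auto simp: scaleC_zero_left scaleC_add_left)

lemma scaleC_minus_left: "(- c) *\<^sub>C (x :: 'a::cstar_algebra) = - (c *\<^sub>C x)"
  using scaleC_add_left[of c "- c" x] by (simp add: scaleC_zero_left eq_neg_iff_add_eq_0 add.commute)

lemma scaleC_scaleR: "c *\<^sub>C r *\<^sub>R x = r *\<^sub>R c *\<^sub>C (x :: 'a::cstar_algebra)"
  unfolding scaleR_scaleC scaleC_scaleC by (simp only: mult.commute)

lemma adj_one: "adj (1 :: 'a::cstar_algebra) = 1"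
  by (metis adj_adj adj_mult mult_1_right mult_1_left)

lemma adj_minus: "adj (- (x :: 'a::cstar_algebra)) = - adj x"
  using adj_add[of x "- x"] by (simp add: adj_zero eq_neg_iff_add_eq_0 add.commute)

lemma adj_diff: "adj ((x :: 'a::cstar_algebra) - y) = adj x - adj y"
  using adj_add[of x "- y"] by (simp add: adj_minus)

lemma adj_sum: "adj (\<Sum>i\<in>I. f i) = (\<Sum>i\<in>I. adj (f i :: 'a::cstar_algebra))"
  by (induction I rule: infinite_finite_induct) (auto simp: adj_zero adj_add)

lemma adj_scaleR: "adj (r *\<^sub>R (x :: 'a::cstar_algebra)) = r *\<^sub>R adj x"
  by (simp add: scaleR_scaleC adj_scaleC)

lemma adj_power: "adj ((x :: 'a::cstar_algebra) ^ k) = adj x ^ k"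
  by (induction k) (auto simp: adj_one adj_mult power_commutes)

lemma norm_adj: "norm (adj x) = norm (x :: 'a::cstar_algebra)"
proof -
  have le: "norm z \<le> norm (adj z)" for z :: 'a
  proof (cases "z = 0")
    case False
    have "norm z * norm z \<le> norm (adj z) * norm z"
      using norm_mult_ineq[of "adj z" z] cstar_identity[of z] by (simp add: power2_eq_square)
    then show ?thesis using False by simp
  qed simp
  from le[of x] le[of "adj x"] show ?thesis by (simp add: adj_adj)
qed

lemma norm_le_1_if_cstar: "norm (x :: 'a::cstar_algebra) \<le> 1" if "norm (adj x * x) \<le> 1"
  using that by (simp add: cstar_identity power_le_one_iff)

lemma norm_projection_le_1:
  fixes p :: "'a::cstar_algebra"
  assumes "adj p = p" "p * p = p"
  shows "norm p \<le> 1"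
proof (cases "p = 0")
  case False
  have "norm p * norm p = 1 * norm p"
    using cstar_identity[of p] assms by (simp add: power2_eq_square)
  then show ?thesis using False by simp
qed simp

lemma bounded_linear_adj: "bounded_linear (adj :: 'a::cstar_algebra \<Rightarrow> 'a)"
  by (rule bounded_linear_intro[where K = 1]) (auto simp: adj_add adj_scaleR norm_adj)

section \<open>Star-homomorphisms are contractive\<close>

text \<open>
  The element \<open>b\<close> is the square root of \<open>1 - h * h\<close>, so that \<open>h \<plusminus> \<i> b\<close> are unitaries.  Writing
  \<open>b = 1 - c\<close> turns \<open>b * b = 1 - h * h\<close> into the fixed point equation \<open>c = (h * h + c * c) / 2\<close>,
  whose right-hand side contracts the ball of radius \<open>r = 1 - sqrt (1 - (norm h)\<^sup>2)\<close>.
\<close>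

lemma selfadjoint_extends_to_unitary:
  fixes h :: "'a::cstar_algebra"
  assumes h: "adj h = h" "norm h < 1"
  obtains b where "adj b = b" "b * h = h * b" "h * h + b * b = 1"
proof -
  define r where "r = 1 - sqrt (1 - (norm h)\<^sup>2)"
  \<comment> \<open>Self-adjointness and commutation with \<open>h\<close> are closed conditions that the iteration
    preserves, so they hold for the fixed point.\<close>
  define D where "D = {c. norm c \<le> r \<and> adj c = c \<and> c * h = h * c}"
  define f where "f = (\<lambda>c. (1/2) *\<^sub>R (h * h + c * c))"
  have h2: "(norm h)\<^sup>2 < 1" using h(2) by (simp add: power_less_one_iff abs_square_less_1)
  then have r: "0 \<le> r" "r < 1" unfolding r_def by (auto simp: real_sqrt_le_1_iff)
  have req: "(norm h)\<^sup>2 + r * r = 2 * r"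
    using h2 unfolding r_def by (simp add: algebra_simps)
  have "closed D"
    unfolding D_def
    by (intro closed_Collect_conj closed_Collect_le closed_Collect_eq continuous_intros
          bounded_linear.continuous_on[OF bounded_linear_adj])
  then have "complete D" by (simp add: complete_eq_closed)
  moreover have "D \<noteq> {}" using r by (auto simp: D_def adj_zero intro!: exI[of _ 0])
  moreover have "f ` D \<subseteq> D"
  proof safe
    fix c assume c: "c \<in> D"
    have "norm (h * h + c * c) \<le> norm h * norm h + norm c * norm c"
      by (intro norm_triangle_le add_mono norm_mult_ineq)
    also have "\<dots> \<le> (norm h)\<^sup>2 + r * r"
      using c r by (auto simp: D_def power2_eq_square intro!: mult_mono)
    finally have "norm (f c) \<le> r" using req by (simp add: f_def)
    moreover have "adj (f c) = f c"
      using c h by (simp add: f_def D_def adj_scaleR adj_add adj_mult)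
    moreover have "f c * h = h * f c"
      using c by (simp add: f_def D_def algebra_simps) (metis mult.assoc)
    ultimately show "f c \<in> D" by (simp add: D_def)
  qed
  moreover have "dist (f c) (f d) \<le> r * dist c d" if "c \<in> D" "d \<in> D" for c d
  proof -
    have "f c - f d = (1/2) *\<^sub>R (c * (c - d) + (c - d) * d)"
      by (simp add: f_def algebra_simps)
    also have "norm \<dots> \<le> (1/2) * (norm c * norm (c - d) + norm (c - d) * norm d)"
      by (auto intro!: norm_triangle_le add_mono norm_mult_ineq)
    also have "\<dots> \<le> (1/2) * (r * norm (c - d) + norm (c - d) * r)"
      using that r by (intro mult_left_mono add_mono mult_mono) (auto simp: D_def)
    finally show ?thesis by (simp add: dist_norm mult.commute)
  qed
  ultimately have "\<exists>!c. c \<in> D \<and> f c = c"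
    using r Banach_fix[of D r f] by auto
  then obtain c where c: "c \<in> D" "f c = c" by blast
  have "2 *\<^sub>R f c = h * h + c * c" by (simp add: f_def)
  then have "h * h + c * c = 2 *\<^sub>R c" by (simp add: c(2))
  then have "h * h + (1 - c) * (1 - c) = 1" by (simp add: algebra_simps scaleR_2)
  then show ?thesis
    using c by (intro that[of "1 - c"]) (auto simp: D_def adj_diff adj_one algebra_simps)
qed

lemma star_hom_wholeD:
  assumes "star_hom cstar_whole cstar_whole \<phi>"
  shows "\<phi> (x + y) = \<phi> x + \<phi> y" "\<phi> (x * y) = \<phi> x * \<phi> y" "\<phi> (c *\<^sub>C x) = c *\<^sub>C \<phi> x"
        "\<phi> (adj x) = adj (\<phi> x)"
  using assms by (auto simp: star_hom_def)

text \<open>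
  Algebra alone bounds the image of a unitary, and a self-adjoint \<open>h\<close> of norm below \<open>1\<close> is the
  average of the unitaries \<open>h \<plusminus> \<i> b\<close>.  General \<open>x\<close> reduce to self-adjoint ones by the
  $C^*$-identity.  The image of \<open>1\<close> is merely a projection, but that suffices.
\<close>

lemma star_hom_contractive:
  fixes \<phi> :: "'a::cstar_algebra \<Rightarrow> 'b::cstar_algebra"
  assumes \<phi>: "star_hom cstar_whole cstar_whole \<phi>"
  shows "norm (\<phi> x) \<le> norm x"
proof -
  note hom = star_hom_wholeD[OF \<phi>]
  have hom_minus: "\<phi> (- x) = - \<phi> x" for x
    using hom(3)[of "-1" x] by (simp add: scaleC_minus_left scaleC_one)
  have hom_diff: "\<phi> (x - y) = \<phi> x - \<phi> y" for x y
    using hom(1)[of x "- y"] by (simp add: hom_minus)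
  have homR: "\<phi> (r *\<^sub>R x) = r *\<^sub>R \<phi> x" for r x by (simp add: scaleR_scaleC hom)
  have p: "norm (\<phi> 1) \<le> 1"
    by (rule norm_projection_le_1) (metis hom(4) adj_one, metis hom(2) mult_1_left)
  have contr: "norm (\<phi> h) \<le> 1" if h: "adj h = h" "norm h < 1" for h
  proof -
    obtain b where b: "adj b = b" "b * h = h * b" "h * h + b * b = 1"
      using selfadjoint_extends_to_unitary[OF h] .
    have u: "norm (\<phi> (h + c *\<^sub>C b)) \<le> 1" if c: "c = \<i> \<or> c = - \<i>" for c
    proof (rule norm_le_1_if_cstar)
      have "adj (h + c *\<^sub>C b) * (h + c *\<^sub>C b) = 1"
        using c b h by (auto simp: adj_add adj_scaleC algebra_simps mult_scaleC_left mult_scaleC_right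
            scaleC_scaleC scaleC_one scaleC_minus_left scaleC_add_right)
      then show "norm (adj (\<phi> (h + c *\<^sub>C b)) * \<phi> (h + c *\<^sub>C b)) \<le> 1"
        using p by (metis hom(2,4))
    qed
    have "\<phi> (h + \<i> *\<^sub>C b) + \<phi> (h + (- \<i>) *\<^sub>C b) = 2 *\<^sub>R \<phi> h"
      by (simp add: hom scaleR_2 scaleC_minus_left hom_diff)
    then have "norm (2 *\<^sub>R \<phi> h) \<le> norm (\<phi> (h + \<i> *\<^sub>C b)) + norm (\<phi> (h + (- \<i>) *\<^sub>C b))"
      by (metis norm_triangle_ineq)
    then show ?thesis using u[of \<i>] u[of "- \<i>"] by simp
  qed
  have sa: "norm (\<phi> h) \<le> norm h" if h: "adj h = h" for h
  proof (rule field_le_epsilon)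
    fix e :: real assume e: "e > 0"
    let ?t = "norm h + e"
    have t: "?t > 0" using e by (simp add: add_nonneg_pos)
    have "norm (\<phi> ((1 / ?t) *\<^sub>R h)) \<le> 1"
      by (rule contr) (use h t e in \<open>auto simp: adj_scaleR\<close>)
    then show "norm (\<phi> h) \<le> ?t" using t by (simp add: homR field_simps)
  qed
  have "(norm (\<phi> x))\<^sup>2 = norm (\<phi> (adj x * x))" by (simp add: hom cstar_identity)
  also have "\<dots> \<le> norm (adj x * x)" by (rule sa) (simp add: adj_mult adj_adj)
  also have "\<dots> = (norm x)\<^sup>2" by (simp add: cstar_identity)
  finally show ?thesis by (rule power2_le_imp_le) simp
qed

lemma bounded_linear_star_hom:
  fixes \<phi> :: "'a::cstar_algebra \<Rightarrow> 'b::cstar_algebra"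
  assumes "star_hom cstar_whole cstar_whole \<phi>"
  shows "bounded_linear \<phi>"
  by (rule bounded_linear_intro[where K = 1])
     (auto simp: star_hom_wholeD[OF assms] scaleR_scaleC star_hom_contractive[OF assms])

section \<open>Orthogonality of the ranges of Cuntz isometries\<close>

text \<open>
  With \<open>p = x * x\<close>, the element \<open>1 + (3/2) x\<close> is the convex combination
  \<open>3/4 (1 + x)\<^sup>2 + 1/4 (1 - 3 p)\<close>.  The second term has norm at most \<open>1\<close> because
  \<open>2 (1 - 3 p) = (1 - 6 p + p\<^sup>2) + (1 - p\<^sup>2)\<close>, where the two summands are the average of
  \<open>(1 \<plusminus> \<i> x) ^ 4\<close> and the product of the four factors \<open>1 \<plusminus> x\<close>, \<open>1 \<plusminus> \<i> x\<close>.
  The factors \<open>1 \<plusminus> \<i> x\<close> are contractions by the $C^*$-identity, since \<open>1 + p\<close> is the average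
  of \<open>(1 \<plusminus> x)\<^sup>2\<close>.
\<close>

lemma norm_one_plus_multiple_le_1:
  fixes x :: "'a::cstar_algebra"
  assumes x: "adj x = x" and n: "norm (1 + x) \<le> 1" "norm (1 - x) \<le> 1"
  shows "norm (1 + (3/2) *\<^sub>R x) \<le> 1"
proof -
  have prod: "norm (a * b) \<le> 1" if "norm a \<le> 1" "norm b \<le> 1" for a b :: 'a
    using that norm_mult_ineq[of a b] mult_mono[of "norm a" 1 "norm b" 1] by auto
  have avg: "norm a \<le> 1" if "a + a = b + c" "norm b \<le> 1" "norm c \<le> 1" for a b c :: 'a
    using that norm_triangle_ineq[of b c] norm_scaleR[of 2 a] by (simp add: scaleR_2)
  define p where "p = x * x"
  define q where "q = \<i> *\<^sub>C x"
  have q2: "q * q = - p"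
    by (simp add: q_def p_def mult_scaleC_left mult_scaleC_right scaleC_scaleC
        scaleC_minus_left scaleC_one)
  have pq: "p * q = q * p"
    by (simp add: q_def p_def mult_scaleC_left mult_scaleC_right mult.assoc)
  have adjq: "adj q = - q" by (simp add: q_def adj_scaleC x scaleC_minus_left)
  have p1: "norm (1 + p) \<le> 1"
    by (rule avg[OF _ prod[OF n(1) n(1)] prod[OF n(2) n(2)]]) (simp add: p_def algebra_simps)
  have q1: "norm (1 + q) \<le> 1" "norm (1 - q) \<le> 1"
    by (rule norm_le_1_if_cstar, use p1 in \<open>simp add: adj_add adj_diff adj_one adjq algebra_simps q2\<close>)+
  have p2: "norm (1 - p * p) \<le> 1"
  proof -
    have "1 - p * p = (1 - x) * (1 + x) * (1 + p)" by (simp add: p_def algebra_simps)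
    then show ?thesis by (simp only: prod n p1)
  qed
  have fourth: "norm (1 - p - p - p - p - p - p + p * p) \<le> 1"
  proof (rule avg)
    have "(1 + q) * (1 + q) = (1 - p) + (q + q)" "(1 - q) * (1 - q) = (1 - p) - (q + q)"
      by (simp_all add: algebra_simps q2)
    then have "(1 + q) * (1 + q) * ((1 + q) * (1 + q)) + (1 - q) * (1 - q) * ((1 - q) * (1 - q)) =
        ((1 - p) + (q + q)) * ((1 - p) + (q + q)) + ((1 - p) - (q + q)) * ((1 - p) - (q + q))"
      by simp
    also have "\<dots> = (1 - p - p - p - p - p - p + p * p) + (1 - p - p - p - p - p - p + p * p)"
      by (simp add: algebra_simps q2 pq)
    finally show "(1 - p - p - p - p - p - p + p * p) + (1 - p - p - p - p - p - p + p * p) =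
      (1 + q) * (1 + q) * ((1 + q) * (1 + q)) + (1 - q) * (1 - q) * ((1 - q) * (1 - q))" by simp
  qed (intro prod q1)+
  have p3: "norm (1 - p - p - p) \<le> 1"
    by (rule avg[OF _ fourth p2]) (simp add: algebra_simps)
  have "4 *\<^sub>R (1 + (3/2) *\<^sub>R x) = 3 *\<^sub>R ((1 + x) * (1 + x)) + (1 - p - p - p)"
  proof -
    have 1: "4 *\<^sub>R z = z + z + z + z" "3 *\<^sub>R z = z + z + z" "6 *\<^sub>R z = z + z + z + z + z + z"
      for z :: 'a
      using scaleR_add_left[of 2 2 z] scaleR_add_left[of 2 1 z] scaleR_add_left[of 4 2 z]
        scaleR_add_left[of 1 1 z] by auto
    have "4 *\<^sub>R (1 + (3/2) *\<^sub>R x) = 4 *\<^sub>R 1 + 6 *\<^sub>R x" by (simp add: scaleR_add_right)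
    then show ?thesis by (simp only: 1) (simp add: p_def algebra_simps)
  qed
  then have "4 * norm (1 + (3/2) *\<^sub>R x) = norm (3 *\<^sub>R ((1 + x) * (1 + x)) + (1 - p - p - p))"
    by (metis norm_scaleR abs_numeral)
  also have "\<dots> \<le> 3 * norm ((1 + x) * (1 + x)) + norm (1 - p - p - p)"
    by (rule norm_triangle_le) simp
  also have "\<dots> \<le> 4" using prod[OF n(1) n(1)] p3 by simp
  finally show ?thesis by simp
qed

text \<open>
  By the preceding lemma the assumption survives replacing \<open>x\<close> by \<open>(3/2) x\<close>, hence by
  \<open>(3/2) ^ k x\<close> for all \<open>k\<close>, while it forces norm at most \<open>1\<close>.
\<close>

lemma one_is_extreme:
  fixes x :: "'a::cstar_algebra"
  assumes x: "adj x = x" and n: "norm (1 + x) \<le> 1" "norm (1 - x) \<le> 1"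
  shows "x = 0"
proof (rule ccontr)
  assume "x \<noteq> 0"
  have *: "norm (1 + (3/2)^k *\<^sub>R x) \<le> 1 \<and> norm (1 - (3/2)^k *\<^sub>R x) \<le> 1" for k
  proof (induction k)
    case 0
    then show ?case using n by simp
  next
    case (Suc k)
    show ?case
      using norm_one_plus_multiple_le_1[of "(3/2)^k *\<^sub>R x"] norm_one_plus_multiple_le_1[of "- ((3/2)^k *\<^sub>R x)"] Suc
      by (simp add: adj_scaleR adj_minus x)
  qed
  obtain k where k: "(3/2 :: real)^k > 1 / norm x"
    using real_arch_pow[of "3/2" "1 / norm x"] by auto
  let ?z = "(3/2)^k *\<^sub>R x"
  have "2 *\<^sub>R ?z = (1 + ?z) - (1 - ?z)" by (simp only: scaleR_2) simp
  then have "norm (2 *\<^sub>R ?z) \<le> norm (1 + ?z) + norm (1 - ?z)"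
    by (simp only: norm_triangle_ineq4)
  then have "2 * norm ?z \<le> 1 + 1" using *[of k] by simp
  then show False using k \<open>x \<noteq> 0\<close> by (simp add: field_simps)
qed

text \<open>
  Compressing the range projections by \<open>S j\<close> gives elements \<open>h k\<close> with \<open>norm (1 - h k) \<le> 1\<close>, a
  substitute for positivity, which sum to \<open>1\<close> while \<open>h j = 1\<close>.  So \<open>- h i\<close> is the sum of the
  remaining \<open>h k\<close>, which bounds \<open>norm (1 + h i / m)\<close> by \<open>1\<close> as well, and extremality of \<open>1\<close>
  yields \<open>h i = 0\<close>.
\<close>

lemma cuntz_isometries_orthogonal:
  fixes S :: "nat \<Rightarrow> 'a::cstar_algebra"
  assumes S: "cuntz_isometries cstar_whole m S" and ij: "i \<in> {1..m}" "j \<in> {1..m}" "i \<noteq> j"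
  shows "adj (S i) * S j = 0"
proof -
  note S' = S[unfolded cuntz_isometries_cstar_whole]
  have iso: "adj (S k) * S k = 1" if "k \<in> {1..m}" for k using S' that by blast
  have Sn: "norm (S k) \<le> 1" if "k \<in> {1..m}" for k
    by (rule norm_le_1_if_cstar) (simp add: iso[OF that])
  define h where "h = (\<lambda>k. adj (S j) * (S k * adj (S k)) * S j)"
  have sum1: "(\<Sum>k=1..m. h k) = 1"
    using S' iso[OF ij(2)] by (simp add: h_def flip: sum_distrib_left sum_distrib_right)
  have hj: "h j = 1"
  proof -
    have "h j = (adj (S j) * S j) * (adj (S j) * S j)" by (simp only: h_def mult.assoc)
    then show ?thesis by (simp add: iso[OF ij(2)])
  qed
  have h1: "norm (1 - h k) \<le> 1" if k: "k \<in> {1..m}" for k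
  proof -
    have "norm (1 - S k * adj (S k)) \<le> 1"
    proof (rule norm_projection_le_1)
      have "(S k * adj (S k)) * (S k * adj (S k)) = S k * (adj (S k) * S k) * adj (S k)"
        by (simp only: mult.assoc)
      then have "(S k * adj (S k)) * (S k * adj (S k)) = S k * adj (S k)" by (simp add: iso[OF k])
      then show "(1 - S k * adj (S k)) * (1 - S k * adj (S k)) = 1 - S k * adj (S k)"
        by (simp add: right_diff_distrib left_diff_distrib)
    qed (simp add: adj_diff adj_one adj_mult adj_adj)
    then have "norm (adj (S j) * (1 - S k * adj (S k)) * S j) \<le> 1 * 1 * 1"
      using Sn[OF ij(2)]
      by (intro order_trans[OF norm_mult_ineq] mult_mono) (auto simp: norm_adj)
    moreover have "adj (S j) * (1 - S k * adj (S k)) * S j = 1 - h k"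
      using iso[OF ij(2)] by (simp add: h_def right_diff_distrib left_diff_distrib)
    ultimately show ?thesis by simp
  qed
  define J where "J = {1..m} - {i, j}"
  have m: "m \<ge> 2" using ij by auto
  have cJ: "real (card J) = real m - 2"
    using ij m by (simp add: J_def card_Diff_subset of_nat_diff)
  have eq: "{1..m} = insert i (insert j J)" using ij by (auto simp: J_def)
  have "(\<Sum>k=1..m. h k) = h i + (h j + sum h J)"
    unfolding eq using ij(3) by (subst sum.insert; simp add: J_def)+
  then have "h i = - sum h J" using sum1 hj by (simp add: eq_neg_iff_add_eq_0)
  moreover have "(\<Sum>k\<in>J. 1 - h k) = real (card J) *\<^sub>R 1 - sum h J"
    by (simp add: sum_subtractf flip: of_real_def)
  ultimately have *: "real m *\<^sub>R 1 + h i = 2 *\<^sub>R 1 + (\<Sum>k\<in>J. 1 - h k)"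
    unfolding cJ scaleR_left_diff_distrib by simp
  \<comment> \<open>The factor \<open>1 / m\<close> makes room for the \<open>m - 2\<close> terms of the sum over \<open>J\<close>; the bound on
    \<open>1 - ?x\<close> follows from the one on \<open>1 - h i\<close> by convexity.\<close>
  let ?x = "(1 / real m) *\<^sub>R h i"
  have "norm (real m *\<^sub>R 1 + h i) \<le> 2 + (\<Sum>k\<in>J. 1)"
    unfolding * by (intro norm_triangle_le add_mono sum_norm_le) (auto simp: J_def h1)
  also have "\<dots> = real m" using cJ by simp
  finally have "norm ((1 / real m) *\<^sub>R (real m *\<^sub>R 1 + h i)) \<le> 1" using m by simp
  then have n1: "norm (1 + ?x) \<le> 1" using m by (simp add: scaleR_add_right)
  have "1 - ?x = (1 - 1 / real m) *\<^sub>R 1 + (1 / real m) *\<^sub>R (1 - h i)"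
    by (simp add: scaleR_left_diff_distrib scaleR_right_diff_distrib)
  also have "norm \<dots> \<le> (1 - 1 / real m) + (1 / real m) * norm (1 - h i)"
    by (rule norm_triangle_le) (use m in simp)
  also have "\<dots> \<le> (1 - 1 / real m) + (1 / real m) * 1"
    using h1[OF ij(1)] by (intro add_left_mono mult_left_mono) auto
  finally have n2: "norm (1 - ?x) \<le> 1" by simp
  have "?x = 0"
    by (rule one_is_extreme[OF _ n1 n2])
       (simp add: h_def adj_scaleR adj_mult adj_adj mult.assoc)
  then have "h i = 0" using m by simp
  then have "adj (adj (S i) * S j) * (adj (S i) * S j) = 0"
    by (simp add: h_def adj_mult adj_adj mult.assoc)
  then show ?thesis using cstar_identity[of "adj (S i) * S j"] by simp
qed

section \<open>$C^*$-subalgebras and star-homomorphisms\<close>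

lemma cstar_generated_subset: "X \<subseteq> cstar_generated X"
  unfolding cstar_generated_def by (rule hull_subset)

lemma cstar_generated_least:
  "X \<subseteq> A \<Longrightarrow> cstar_subalgebra A \<Longrightarrow> cstar_generated X \<subseteq> A"
  unfolding cstar_generated_def by (rule hull_minimal)

lemma cstar_subalgebraD:
  assumes "cstar_subalgebra A"
  shows "0 \<in> A" "x \<in> A \<Longrightarrow> y \<in> A \<Longrightarrow> x + y \<in> A" "x \<in> A \<Longrightarrow> y \<in> A \<Longrightarrow> x * y \<in> A"
    "x \<in> A \<Longrightarrow> c *\<^sub>C x \<in> A" "x \<in> A \<Longrightarrow> adj x \<in> A" "closed A"
    "x \<in> A \<Longrightarrow> r *\<^sub>R x \<in> A" "(\<And>i. i \<in> I \<Longrightarrow> f i \<in> A) \<Longrightarrow> sum f I \<in> A"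
proof -
  show *: "0 \<in> A" "x \<in> A \<Longrightarrow> y \<in> A \<Longrightarrow> x + y \<in> A" "x \<in> A \<Longrightarrow> y \<in> A \<Longrightarrow> x * y \<in> A"
    "x \<in> A \<Longrightarrow> c *\<^sub>C x \<in> A" "x \<in> A \<Longrightarrow> adj x \<in> A" "closed A" for x y c
    using assms by (auto simp: cstar_subalgebra_def star_subalgebra_def)
  show "x \<in> A \<Longrightarrow> r *\<^sub>R x \<in> A" by (simp add: scaleR_scaleC *)
  show "(\<And>i. i \<in> I \<Longrightarrow> f i \<in> A) \<Longrightarrow> sum f I \<in> A"
    by (induction I rule: infinite_finite_induct) (auto intro: *)
qed

lemma star_hom_wholeI:
  fixes \<phi> :: "'a::cstar_algebra \<Rightarrow> 'b::cstar_algebra"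
  assumes "\<And>x y. \<phi> (x + y) = \<phi> x + \<phi> y" "\<And>x y. \<phi> (x * y) = \<phi> x * \<phi> y"
    "\<And>c x. \<phi> (c *\<^sub>C x) = c *\<^sub>C \<phi> x" "\<And>x. \<phi> (adj x) = adj (\<phi> x)"
  shows "star_hom cstar_whole cstar_whole \<phi>"
  using assms by (auto simp: star_hom_def)

lemma star_hom_linear:
  fixes \<phi> :: "'a::cstar_algebra \<Rightarrow> 'b::cstar_algebra"
  assumes \<phi>: "star_hom cstar_whole cstar_whole \<phi>"
  shows "\<phi> (r *\<^sub>R x) = r *\<^sub>R \<phi> x" "\<phi> (sum f I) = (\<Sum>i\<in>I. \<phi> (f i))" "\<phi> 0 = 0"
    "\<phi> (x - y) = \<phi> x - \<phi> y" "\<phi> (- x) = - \<phi> x"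
  using bounded_linear.linear[OF bounded_linear_star_hom[OF \<phi>]]
  by (auto simp: linear_cmul linear_sum linear_0 linear_diff linear_neg)

lemma star_hom_continuous_on:
  fixes \<phi> :: "'a::cstar_algebra \<Rightarrow> 'b::cstar_algebra"
  assumes "star_hom cstar_whole cstar_whole \<phi>"
  shows "continuous_on A \<phi>"
  by (rule bounded_linear.continuous_on[OF bounded_linear_star_hom[OF assms] continuous_on_id])

lemma cstar_subalgebra_vimage:
  fixes \<phi> :: "'a::cstar_algebra \<Rightarrow> 'b::cstar_algebra"
  assumes \<phi>: "star_hom cstar_whole cstar_whole \<phi>" and A: "cstar_subalgebra A"
  shows "cstar_subalgebra (\<phi> -` A)"
proof -
  have "closed (\<phi> -` A)"
    by (rule closed_vimage[OF cstar_subalgebraD(6)[OF A] star_hom_continuous_on[OF \<phi>]])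
  then show ?thesis
    using A by (auto simp: cstar_subalgebra_def star_subalgebra_def star_hom_wholeD[OF \<phi>] star_hom_linear[OF \<phi>])
qed

lemma cstar_subalgebra_fixed:
  fixes \<phi> :: "'a::cstar_algebra \<Rightarrow> 'a"
  assumes \<phi>: "star_hom cstar_whole cstar_whole \<phi>"
  shows "cstar_subalgebra {x. \<phi> x = x}"
proof -
  have "closed {x. \<phi> x = x}"
    by (intro closed_Collect_eq star_hom_continuous_on[OF \<phi>] continuous_on_id)
  then show ?thesis
    by (auto simp: cstar_subalgebra_def star_subalgebra_def star_hom_wholeD[OF \<phi>] star_hom_linear[OF \<phi>])
qed

lemma cstar_subalgebra_range:
  fixes \<phi> :: "'a::cstar_algebra \<Rightarrow> 'b::cstar_algebra"
  assumes \<phi>: "star_hom cstar_whole cstar_whole \<phi>" and below: "\<And>x. norm x \<le> norm (\<phi> x)"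
  shows "cstar_subalgebra (range \<phi>)"
proof -
  have "complete (range \<phi>)"
    by (rule complete_isometric_image[of 1])
       (use below bounded_linear_star_hom[OF \<phi>] in \<open>auto simp: complete_UNIV\<close>)
  then have "closed (range \<phi>)" by (simp add: complete_eq_closed)
  moreover have "star_subalgebra (range \<phi>)"
    unfolding star_subalgebra_def
    by (auto simp: star_hom_wholeD[OF \<phi>, symmetric] intro: range_eqI[where x = 0] simp: star_hom_linear[OF \<phi>])
  ultimately show ?thesis by (simp add: cstar_subalgebra_def)
qed

lemma star_hom_Ad:
  fixes u :: "'a::cstar_algebra"
  assumes "adj u * u = 1"
  shows "star_hom cstar_whole cstar_whole (Ad u)"
proof (rule star_hom_wholeI)
  fix x y
  have "Ad u x * Ad u y = u * x * (adj u * u) * y * adj u" by (simp only: Ad_def mult.assoc)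
  then show "Ad u (x * y) = Ad u x * Ad u y" by (simp add: assms Ad_def mult.assoc)
qed (simp_all add: Ad_def algebra_simps mult_scaleC_left mult_scaleC_right adj_mult adj_adj)

lemma Ad_power: "Ad (u ^ Suc l) x = Ad u (Ad (u ^ l) (x :: 'a::cstar_algebra))"
  by (simp add: Ad_def adj_power adj_mult mult.assoc power_commutes)

text \<open>
  Both hypotheses on \<open>X\<close> are needed together: the adjoint exchanges them, so the set of all \<open>x\<close>
  that satisfy both is a $C^*$-subalgebra.
\<close>

lemma star_hom_intertwined_by_isometry:
  fixes \<theta> :: "'a::cstar_algebra \<Rightarrow> 'a"
  assumes \<theta>: "star_hom cstar_whole cstar_whole \<theta>" and gen: "cstar_generated X = UNIV"
    and w: "adj w * w = 1" and X: "\<And>x. x \<in> X \<Longrightarrow> \<theta> x * w = w * x \<and> adj w * \<theta> x = x * adj w"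
  shows "\<theta> x * w = w * x"
proof -
  let ?A = "{x. \<theta> x * w = w * x \<and> adj w * \<theta> x = x * adj w}"
  have "cstar_subalgebra ?A"
    unfolding cstar_subalgebra_def star_subalgebra_def
  proof (intro conjI ballI allI)
    show "closed ?A"
      by (intro closed_Collect_conj closed_Collect_eq continuous_intros star_hom_continuous_on[OF \<theta>])
  next
    fix x y assume "x \<in> ?A" "y \<in> ?A"
    then have xy: "\<theta> x * w = w * x" "adj w * \<theta> x = x * adj w" "\<theta> y * w = w * y" "adj w * \<theta> y = y * adj w"
      by auto
    have "\<theta> x * \<theta> y * w = w * (x * y)" by (simp add: mult.assoc xy(3)) (simp add: xy(1) flip: mult.assoc)
    moreover have "adj w * (\<theta> x * \<theta> y) = x * y * adj w"
      by (simp add: xy(2) flip: mult.assoc) (simp add: mult.assoc xy(4))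
    ultimately show "x * y \<in> ?A" by (simp add: star_hom_wholeD[OF \<theta>])
  next
    fix x assume x: "x \<in> ?A"
    then have "adj (\<theta> x * w) = adj (w * x)" "adj (adj w * \<theta> x) = adj (x * adj w)" by auto
    then show "adj x \<in> ?A" by (simp add: star_hom_wholeD[OF \<theta>] adj_mult adj_adj)
  qed (auto simp: star_hom_wholeD[OF \<theta>] star_hom_linear[OF \<theta>] algebra_simps mult_scaleC_left mult_scaleC_right)
  then have "cstar_generated X \<subseteq> ?A" using X by (intro cstar_generated_least) auto
  then show ?thesis using gen by auto
qed

lemma cstar_generated_scale:
  assumes r: "r \<noteq> 0"
  shows "cstar_generated ((\<lambda>x. r *\<^sub>R x) ` X) = cstar_generated X"
proof
  show "cstar_generated ((\<lambda>x. r *\<^sub>R x) ` X) \<subseteq> cstar_generated X"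
    using cstar_subalgebraD(7)[OF cstar_subalgebra_cstar_generated, of _ X] cstar_generated_subset[of X]
    by (intro cstar_generated_least cstar_subalgebra_cstar_generated) blast
  have "x \<in> cstar_generated ((\<lambda>x. r *\<^sub>R x) ` X)" if "x \<in> X" for x
  proof -
    have "inverse r *\<^sub>R (r *\<^sub>R x) \<in> cstar_generated ((\<lambda>x. r *\<^sub>R x) ` X)"
      by (rule cstar_subalgebraD(7)[OF cstar_subalgebra_cstar_generated],
          rule subsetD[OF cstar_generated_subset], rule imageI[OF that])
    then show ?thesis using r by simp
  qed
  then show "cstar_generated X \<subseteq> cstar_generated ((\<lambda>x. r *\<^sub>R x) ` X)"
    by (intro cstar_generated_least cstar_subalgebra_cstar_generated) blast
qed

section \<open>Cuntz families indexed by a cyclic group\<close>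

lemma sum_periodic_shift:
  fixes f :: "nat \<Rightarrow> 'b::ab_group_add"
  assumes per: "\<And>k. f (k mod m) = f k"
  shows "(\<Sum>k<m. f (k + l)) = (\<Sum>k<m. f k)"
proof (induction l)
  case (Suc l)
  have "f (m + l) = f l" using per[of "m + l"] per[of l] by simp
  then have "(\<Sum>k<m. f (Suc k + l)) = (\<Sum>k<m. f (k + l))"
    using sum.lessThan_Suc_shift[of "\<lambda>k. f (k + l)" m] sum.lessThan_Suc[of "\<lambda>k. f (k + l)" m]
    by simp
  then show ?case using Suc by simp
qed simp

text \<open>
  Indexing by all natural numbers, read modulo \<open>m\<close>, lets cyclic shifts of the index be written as
  plain addition.  The orthogonality relations are included because linear combinations of the
  isometries are formed later.
\<close>

definition cyclic_cuntz :: "nat \<Rightarrow> (nat \<Rightarrow> 'a::cstar_algebra) \<Rightarrow> bool" where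
  "cyclic_cuntz m s \<longleftrightarrow> m > 0 \<and> (\<forall>k. s (k mod m) = s k) \<and>
     (\<forall>a b. adj (s a) * s b = (if a mod m = b mod m then 1 else 0)) \<and>
     (\<Sum>k<m. s k * adj (s k)) = 1"

lemma cyclic_cuntzD:
  assumes "cyclic_cuntz m s"
  shows "m > 0" "s (k mod m) = s k"
    "adj (s a) * s b = (if a mod m = b mod m then 1 else 0)"
    "(\<Sum>k<m. s k * adj (s k)) = 1"
  using assms by (auto simp: cyclic_cuntz_def)

lemma cyclic_cuntz_cong:
  assumes "cyclic_cuntz m s" "a mod m = b mod m"
  shows "s a = s b"
  using cyclic_cuntzD(2)[OF assms(1)] assms(2) by metis

lemma cyclic_cuntz_sum_shift:
  assumes "cyclic_cuntz m s"
  shows "(\<Sum>k<m. s (k + l) * adj (s (k + l))) = 1"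
  using sum_periodic_shift[of "\<lambda>k. s k * adj (s k)" m l] cyclic_cuntzD[OF assms] by simp

lemma cyclic_cuntz_shift:
  assumes "cyclic_cuntz m s"
  shows "cyclic_cuntz m (\<lambda>k. s (k + l))"
proof -
  have "(a + l) mod m = (b + l) mod m \<longleftrightarrow> a mod m = b mod m" for a b
    by (auto simp: nat_mod_eq_iff algebra_simps)
  moreover have "s (k mod m + l) = s (k + l)" for k
    by (rule cyclic_cuntz_cong[OF assms]) (simp add: mod_simps)
  ultimately show ?thesis
    using cyclic_cuntzD[OF assms] cyclic_cuntz_sum_shift[OF assms, of l]
    by (auto simp: cyclic_cuntz_def)
qed

text \<open>
  Composition of matrix units: this one rule evaluates the products of all the sums below.  The
  offset \<open>l\<close> serves to bring both factors to the same indexing.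
\<close>

lemma cyclic_cuntz_mult_sums:
  assumes "cyclic_cuntz m s"
  shows "(\<Sum>i<m. x i * adj (s (i + l))) * (\<Sum>k<m. s (k + l) * y k) = (\<Sum>i<m. x i * y i)"
proof -
  have "x i * adj (s (i + l)) * (s (k + l) * y k) = (if k = i then x i * y i else 0)"
    if "i < m" "k < m" for i k
  proof -
    have "x i * adj (s (i + l)) * (s (k + l) * y k) = x i * (adj (s (i + l)) * s (k + l)) * y k"
      by (simp only: mult.assoc)
    then show ?thesis
      using cyclic_cuntzD(3)[OF cyclic_cuntz_shift[OF assms, of l], of i k] that by auto
  qed
  then have "(\<Sum>i<m. x i * adj (s (i + l))) * (\<Sum>k<m. s (k + l) * y k) =
    (\<Sum>i<m. \<Sum>k<m. if k = i then x i * y i else 0)"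
    unfolding sum_product by (intro sum.cong refl) auto
  then show ?thesis by simp
qed

definition primitive_root :: "nat \<Rightarrow> complex \<Rightarrow> bool" where
  "primitive_root m z \<longleftrightarrow> m > 0 \<and> (\<forall>d. z ^ d = 1 \<longleftrightarrow> m dvd d)"

lemma primitive_root_cnj: "primitive_root m (cnj z) \<longleftrightarrow> primitive_root m z"
  unfolding primitive_root_def
  by (metis complex_cnj_cancel_iff complex_cnj_one complex_cnj_power)

lemma primitive_root_mult_cnj:
  assumes "primitive_root m z"
  shows "z * cnj z = 1"
proof -
  have "z ^ m = 1" using assms by (simp add: primitive_root_def)
  then have "cmod z ^ m = 1" by (metis norm_one norm_power)
  then have "cmod z = 1"
    using assms by (metis norm_ge_zero power_eq_1_iff primitive_root_def not_gr0 abs_of_nonneg real_norm_def)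
  then show ?thesis by (simp add: complex_norm_square[symmetric])
qed

lemma primitive_root_power_mod:
  assumes "primitive_root m z"
  shows "z ^ (k mod m) = z ^ k"
proof -
  have zm: "z ^ m = 1" using assms by (simp add: primitive_root_def)
  have "z ^ k = z ^ (m * (k div m) + k mod m)" by simp
  also have "\<dots> = z ^ (k mod m)"
    unfolding power_add power_mult zm by simp
  finally show ?thesis ..
qed

lemma primitive_root_power_cnj_eq_1:
  assumes z: "primitive_root m z"
  shows "z ^ a * cnj z ^ b = 1 \<longleftrightarrow> a mod m = b mod m"
proof -
  have le: "z ^ a * cnj z ^ b = 1 \<longleftrightarrow> a mod m = b mod m"
    if z: "primitive_root m z" and "a \<ge> b" for z a b
  proof -
    have "z ^ a * cnj z ^ b = z ^ (a - b) * (z * cnj z) ^ b"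
      using \<open>a \<ge> b\<close> by (simp add: power_mult_distrib flip: power_add)
    also have "\<dots> = z ^ (a - b)" by (simp add: primitive_root_mult_cnj[OF z])
    finally show ?thesis
      using z \<open>a \<ge> b\<close> by (simp add: primitive_root_def mod_eq_dvd_iff_nat)
  qed
  show ?thesis
  proof (cases "a \<ge> b")
    case False
    then show ?thesis
      using le[of "cnj z" a b] le[of "cnj z" b a] z by (auto simp: primitive_root_cnj mult.commute)
  qed (use le z in blast)
qed

lemma primitive_root_orthogonality:
  assumes z: "primitive_root m z"
  shows "(\<Sum>q<m. z ^ (q * a) * cnj z ^ (q * b)) = (if a mod m = b mod m then of_nat m else 0)"
proof -
  define w where "w = z ^ a * cnj z ^ b"
  have eq: "z ^ (q * a) * cnj z ^ (q * b) = w ^ q" for q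
    by (simp add: w_def power_mult_distrib power_mult mult.commute[of q] flip: power_mult)
  have "z ^ (a * m) = 1" "z ^ (b * m) = 1" using z by (simp_all add: primitive_root_def)
  then have "w ^ m = 1"
    by (simp add: w_def power_mult_distrib flip: power_mult complex_cnj_power)
  moreover have "w = 1 \<longleftrightarrow> a mod m = b mod m"
    unfolding w_def by (rule primitive_root_power_cnj_eq_1[OF z])
  ultimately show ?thesis by (cases "w = 1") (simp_all add: eq geometric_sum)
qed

definition fourier :: "nat \<Rightarrow> complex \<Rightarrow> (nat \<Rightarrow> 'a::cstar_algebra) \<Rightarrow> nat \<Rightarrow> 'a" where
  "fourier m z s l = (1 / sqrt (real m)) *\<^sub>R (\<Sum>q<m. z ^ (q * l) *\<^sub>C s q)"

lemma fourier_fourier_cnj: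
  assumes z: "primitive_root m z" and per: "\<And>k. s (k mod m) = s k"
  shows "fourier m z (fourier m (cnj z) s) l = (s l :: 'a::cstar_algebra)"
proof -
  have m: "m > 0" using z by (simp add: primitive_root_def)
  have "(\<Sum>q<m. z ^ (q * l) *\<^sub>C (\<Sum>p<m. cnj z ^ (p * q) *\<^sub>C s p)) =
        (\<Sum>p<m. \<Sum>q<m. (z ^ (q * l) * cnj z ^ (q * p)) *\<^sub>C s p)"
    by (subst sum.swap) (simp add: scaleC_sum_right scaleC_scaleC mult.commute)
  also have "\<dots> = (\<Sum>p<m. if p = l mod m then of_nat m *\<^sub>C s l else 0)"
    by (rule sum.cong)
       (auto simp: primitive_root_orthogonality[OF z] per scaleC_zero_left simp flip: scaleC_sum_left)
  also have "\<dots> = real m *\<^sub>R s l" using m by (simp add: scaleR_scaleC)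
  finally have *: "(\<Sum>q<m. z ^ (q * l) *\<^sub>C (\<Sum>p<m. cnj z ^ (p * q) *\<^sub>C s p)) = real m *\<^sub>R s l" .
  have "fourier m z (fourier m (cnj z) s) l =
    (1 / sqrt m * (1 / sqrt m)) *\<^sub>R (\<Sum>q<m. z ^ (q * l) *\<^sub>C (\<Sum>p<m. cnj z ^ (p * q) *\<^sub>C s p))"
    unfolding fourier_def scaleC_scaleR scaleR_sum_right[symmetric] by simp
  then show ?thesis using m unfolding * by simp
qed

text \<open>
  The coefficient matrix of the Fourier transform is unitary: orthonormality of the columns gives
  the relations between the new isometries, that of the rows the sum of the range projections.
\<close>

lemma cyclic_cuntz_fourier:
  assumes z: "primitive_root m z" and s: "cyclic_cuntz m s"
  shows "cyclic_cuntz m (fourier m z s)"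
  unfolding cyclic_cuntz_def
proof (intro conjI allI)
  note sD = cyclic_cuntzD[OF s]
  show m: "m > 0" by (rule sD)
  have pw: "z ^ (q * (k mod m)) = z ^ (q * k)" for q k
    by (metis mult.commute power_mult primitive_root_power_mod[OF z])
  show "fourier m z s (k mod m) = fourier m z s k" for k
    by (simp add: fourier_def pw)
  show "adj (fourier m z s a) * fourier m z s b = (if a mod m = b mod m then 1 else 0)" for a b
  proof -
    have "adj (fourier m z s a) * fourier m z s b = (1 / real m) *\<^sub>R
       ((\<Sum>q<m. (cnj z ^ (q * a) *\<^sub>C 1) * adj (s (q + 0))) * (\<Sum>q<m. s (q + 0) * (z ^ (q * b) *\<^sub>C 1)))"
      using m by (simp add: fourier_def adj_scaleR adj_sum adj_scaleC mult_scaleC_left mult_scaleC_right)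
    also have "\<dots> = (1 / real m) *\<^sub>R ((\<Sum>q<m. z ^ (q * b) * cnj z ^ (q * a)) *\<^sub>C 1)"
      unfolding cyclic_cuntz_mult_sums[OF s]
      by (simp add: mult_scaleC_left mult_scaleC_right scaleC_scaleC scaleC_sum_left mult.commute)
    also have "\<dots> = (if a mod m = b mod m then 1 else 0)"
      using m by (auto simp: primitive_root_orthogonality[OF z] scaleR_scaleC scaleC_scaleC scaleC_one scaleC_zero_right scaleC_zero_left)
    finally show ?thesis .
  qed
  have "(\<Sum>l<m. fourier m z s l * adj (fourier m z s l)) =
     (\<Sum>l<m. (1 / real m) *\<^sub>R (\<Sum>q<m. \<Sum>p<m. (cnj z ^ (p * l) * z ^ (q * l)) *\<^sub>C (s q * adj (s p))))"
    using m by (simp add: fourier_def adj_scaleR adj_sum adj_scaleC mult_scaleC_left mult_scaleC_right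
        sum_product scaleC_scaleC)
  also have "\<dots> = (1 / real m) *\<^sub>R (\<Sum>q<m. \<Sum>p<m. \<Sum>l<m. (cnj z ^ (p * l) * z ^ (q * l)) *\<^sub>C (s q * adj (s p)))"
    unfolding scaleR_sum_right[symmetric]
    by (subst sum.swap, rule arg_cong[where f = "\<lambda>x. _ *\<^sub>R x"], rule sum.cong[OF refl], rule sum.swap)
  also have "\<dots> = (1 / real m) *\<^sub>R (\<Sum>q<m. \<Sum>p<m. if p = q then of_nat m *\<^sub>C (s q * adj (s q)) else 0)"
  proof (intro arg_cong[where f = "\<lambda>x. _ *\<^sub>R x"] sum.cong refl)
    fix q p assume qp: "q \<in> {..<m}" "p \<in> {..<m}"
    have "(\<Sum>l<m. cnj z ^ (p * l) * z ^ (q * l)) = (if q mod m = p mod m then of_nat m else 0)"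
      using primitive_root_orthogonality[OF z, of q p]
      by (simp only: mult.commute)
    then show "(\<Sum>l<m. (cnj z ^ (p * l) * z ^ (q * l)) *\<^sub>C (s q * adj (s p))) =
       (if p = q then of_nat m *\<^sub>C (s q * adj (s q)) else 0)"
      using qp by (auto simp: scaleC_zero_left simp flip: scaleC_sum_left)
  qed
  also have "\<dots> = (1 / real m) *\<^sub>R (of_nat m *\<^sub>C (\<Sum>q<m. s q * adj (s q)))"
    by (simp add: scaleC_sum_right)
  also have "\<dots> = 1"
    using m by (simp add: sD(4) scaleR_scaleC scaleC_scaleC scaleC_one)
  finally show "(\<Sum>l<m. fourier m z s l * adj (fourier m z s l)) = 1" .
qed

text \<open>
  The clock matrix over the range projections.  On the Fourier transformed family it acts as the
  cyclic shift of the index (\<open>clock_power_fourier\<close>).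
\<close>

definition clock :: "nat \<Rightarrow> complex \<Rightarrow> (nat \<Rightarrow> 'a::cstar_algebra) \<Rightarrow> 'a" where
  "clock m z s = (\<Sum>q<m. z ^ q *\<^sub>C (s q * adj (s q)))"

lemma clock_mult:
  assumes z: "primitive_root m z" and s: "cyclic_cuntz m s"
  shows "clock m z s * s a = z ^ a *\<^sub>C s a"
proof -
  note sD = cyclic_cuntzD[OF s]
  have "clock m z s * s a = (\<Sum>q<m. z ^ q *\<^sub>C (s q * (adj (s q) * s a)))"
    by (simp add: clock_def sum_distrib_right mult_scaleC_left mult.assoc)
  also have "\<dots> = (\<Sum>q<m. if q = a mod m then z ^ a *\<^sub>C s a else 0)"
    by (rule sum.cong)
      (use sD in \<open>auto simp: scaleC_zero_right primitive_root_power_mod[OF z]\<close>)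
  also have "\<dots> = z ^ a *\<^sub>C s a" using sD(1) by simp
  finally show ?thesis .
qed

lemma clock_power_mult:
  assumes z: "primitive_root m z" and s: "cyclic_cuntz m s"
  shows "clock m z s ^ l * s a = z ^ (a * l) *\<^sub>C s a"
  by (induction l) (simp_all add: scaleC_one mult.assoc mult_scaleC_right clock_mult[OF z s]
    scaleC_scaleC power_add mult.commute)

lemma adj_clock:
  "adj (clock m z s) = clock m (cnj z) s"
  by (simp add: clock_def adj_sum adj_scaleC adj_mult adj_adj)

lemma cyclic_cuntz_eqI:
  assumes s: "cyclic_cuntz m s" and eq: "\<And>a. x * s a = y * s a"
  shows "x = y"
proof -
  have "x = (\<Sum>k<m. x * s k * adj (s k))"
    using cyclic_cuntzD(4)[OF s] by (simp add: mult.assoc flip: sum_distrib_left)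
  also have "\<dots> = (\<Sum>k<m. y * s k * adj (s k))" by (simp add: eq)
  also have "\<dots> = y"
    using cyclic_cuntzD(4)[OF s] by (simp add: mult.assoc flip: sum_distrib_left)
  finally show ?thesis .
qed

lemma clock_unitary:
  assumes z: "primitive_root m z" and s: "cyclic_cuntz m s"
  shows "adj (clock m z s) * clock m z s = 1" "clock m z s * adj (clock m z s) = 1"
proof -
  have z': "primitive_root m (cnj z)" using z by (simp add: primitive_root_cnj)
  have 1: "(z ^ a * cnj z ^ a) = 1" for a
    by (simp add: primitive_root_mult_cnj[OF z] flip: power_mult_distrib)
  show "adj (clock m z s) * clock m z s = 1" "clock m z s * adj (clock m z s) = 1"
    by (rule cyclic_cuntz_eqI[OF s]; simp add: mult.assoc adj_clock clock_mult[OF z s] clock_mult[OF z' s]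
         mult_scaleC_right scaleC_scaleC 1 mult.commute[of "cnj z ^ _"] scaleC_one)+
qed

lemma clock_power_order:
  assumes z: "primitive_root m z" and s: "cyclic_cuntz m s"
  shows "clock m z s ^ m = 1"
proof (rule cyclic_cuntz_eqI[OF s])
  fix a
  have "z ^ (a * m) = 1" using z by (simp add: primitive_root_def)
  then show "clock m z s ^ m * s a = 1 * s a" by (simp add: clock_power_mult[OF z s] scaleC_one)
qed

lemma clock_power_fourier:
  assumes z: "primitive_root m z" and s: "cyclic_cuntz m s"
  shows "clock m z s ^ k * fourier m z s l = fourier m z s (k + l)"
  by (simp add: fourier_def sum_distrib_left mult_scaleC_right clock_power_mult[OF z s] scaleC_scaleC
      add_mult_distrib2 power_add mult.commute)

section \<open>The exchange automorphism as a rotation by half a turn\<close>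

text \<open>
  The relabelled situation: \<open>lam\<close> is the exchange automorphism, and the universal property is
  restated for cyclically indexed families.
\<close>

locale exchange_setting =
  fixes n :: nat and t :: "nat \<Rightarrow> 'a::cstar_algebra" and lam :: "'a \<Rightarrow> 'a" and z :: complex
  assumes n: "n \<ge> 1"
    and cyc: "cyclic_cuntz (2*n) t"
    and gen: "cstar_generated (range t) = UNIV"
    and univ: "\<And>R. cyclic_cuntz (2*n) R \<Longrightarrow>
                 \<exists>\<phi>. star_hom cstar_whole cstar_whole \<phi> \<and> (\<forall>q. \<phi> (t q) = (R q :: 'a))"
    and lam: "star_hom cstar_whole cstar_whole lam"
    and lam_t: "\<And>q. lam (t q) = t (q + n)"
    and z: "primitive_root (2*n) z"
begin

abbreviation "v \<equiv> clock (2*n) z t"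
abbreviation "W \<equiv> fourier (2*n) z t"

text \<open>
  The generators \<open>y_elem\<close>, normalised to be isometries.
\<close>

definition Y :: "nat \<Rightarrow> nat \<Rightarrow> 'a" where
  "Y j l = Ad (v ^ l) (v ^ (2*j) * W 0)"

lemmas v_unitary = clock_unitary[OF z cyc]
lemmas W_cyc = cyclic_cuntz_fourier[OF z cyc]
lemmas vW = clock_power_fourier[OF z cyc]

lemma v_power_unitary: "adj (v ^ l) * v ^ l = 1" "v ^ l * adj (v ^ l) = 1"
proof -
  have "adj (v ^ l) * v ^ l = 1 \<and> v ^ l * adj (v ^ l) = 1"
  proof (induction l)
    case (Suc l)
    have "adj (v ^ Suc l) * v ^ Suc l = adj (v ^ l) * (adj v * v) * v ^ l"
      "v ^ Suc l * adj (v ^ Suc l) = v * (v ^ l * adj (v ^ l)) * adj v"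
      by (simp_all only: power_Suc adj_mult mult.assoc)
    then show ?case using Suc by (simp add: v_unitary)
  qed (simp add: adj_one)
  then show "adj (v ^ l) * v ^ l = 1" "v ^ l * adj (v ^ l) = 1" by auto
qed

lemma Y_eq: "Y j l = W (l + 2*j) * adj (v ^ l)"
  by (simp add: Y_def Ad_def vW flip: mult.assoc)

lemma v_power_mod: "v ^ (l mod (2*n)) = v ^ l"
proof -
  have "v ^ l = v ^ (2*n * (l div (2*n)) + l mod (2*n))" by simp
  also have "\<dots> = v ^ (l mod (2*n))"
    unfolding power_add power_mult[of _ "2*n"] clock_power_order[OF z cyc] by simp
  finally show ?thesis ..
qed

lemma Y_mod: "Y j (l mod (2*n)) = Y j l"
  by (simp add: Y_def v_power_mod)

lemma cyclic_cuntz_Y: "cyclic_cuntz (2*n) (Y j)"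
  unfolding cyclic_cuntz_def
proof (intro conjI allI)
  note WD = cyclic_cuntzD[OF W_cyc]
  show "0 < 2 * n" using n by simp
  show "Y j (k mod (2*n)) = Y j k" for k by (rule Y_mod)
  show "adj (Y j a) * Y j b = (if a mod (2*n) = b mod (2*n) then 1 else 0)" for a b
  proof -
    have "adj (Y j a) * Y j b = v ^ a * (adj (W (a + 2*j)) * W (b + 2*j)) * adj (v ^ b)"
      by (simp add: Y_eq adj_mult adj_adj mult.assoc)
    also have "\<dots> = (if a mod (2*n) = b mod (2*n) then v ^ a * adj (v ^ b) else 0)"
      using cyclic_cuntzD(3)[OF cyclic_cuntz_shift[OF W_cyc, of "2*j"], of a b] by simp
    also have "\<dots> = (if a mod (2*n) = b mod (2*n) then 1 else 0)"
      by (metis v_power_mod v_power_unitary(2))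
    finally show ?thesis .
  qed
  have "Y j l * adj (Y j l) = W (l + 2*j) * (adj (v ^ l) * v ^ l) * adj (W (l + 2*j))" for l
    by (simp only: Y_eq adj_mult adj_adj mult.assoc)
  then show "(\<Sum>l<2*n. Y j l * adj (Y j l)) = 1"
    by (simp add: v_power_unitary cyclic_cuntz_sum_shift[OF W_cyc])
qed

section \<open>The fixed-point algebra\<close>

lemma z_power_n: "z ^ n = - 1"
proof -
  have "z ^ n \<noteq> 1" "z ^ (2*n) = 1" using z n by (auto simp: primitive_root_def dest: dvd_imp_le)
  then show ?thesis by (metis power2_eq_1_iff power_mult mult.commute)
qed

text \<open>
  The half turn moves the eigenvalue \<open>z ^ q\<close> to the position \<open>q + n\<close>, and \<open>z ^ n = - 1\<close>.
\<close>

lemma lam_v: "lam v = - v"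
proof -
  let ?f = "\<lambda>q. z ^ q *\<^sub>C (t q * adj (t q))"
  have "?f (q mod (2*n)) = ?f q" for q
    by (simp add: primitive_root_power_mod[OF z] cyclic_cuntzD(2)[OF cyc])
  then have "(\<Sum>q<2*n. ?f (q + n)) = v"
    unfolding clock_def by (rule sum_periodic_shift)
  moreover have "?f (q + n) = - lam (?f q)" for q
    by (simp add: star_hom_wholeD[OF lam] lam_t power_add z_power_n scaleC_minus_left)
  ultimately have "- lam v = v"
    by (simp add: clock_def star_hom_linear[OF lam] sum_negf)
  then show ?thesis by (metis minus_minus)
qed

lemma lam_W0: "lam (W 0) = W 0"
  using sum_periodic_shift[of t "2*n" n] cyclic_cuntzD(2)[OF cyc]
  by (simp add: fourier_def scaleC_one star_hom_linear[OF lam] lam_t)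

lemma lam_1: "lam 1 = 1"
  using cyclic_cuntz_sum_shift[OF cyc, of n] star_hom_linear(2)[OF lam, of "\<lambda>k. t k * adj (t k)" "{..<2*n}"]
    cyclic_cuntzD(4)[OF cyc] by (simp add: star_hom_wholeD[OF lam] lam_t)

lemma lam_v_power: "lam (v ^ l) = (- 1) ^ l *\<^sub>R v ^ l"
  by (induction l) (simp_all add: lam_1 star_hom_wholeD[OF lam] lam_v)

lemma lam_Y: "lam (Y j l) = Y j l"
proof -
  have "lam (Y j l) = ((-1) ^ l * (-1) ^ (2*j) * (-1) ^ l) *\<^sub>R Y j l"
    by (simp add: Y_def Ad_def star_hom_wholeD[OF lam] lam_W0 lam_v_power adj_scaleR)
  also have "(-1) ^ l * (-1) ^ (2*j) * (-1) ^ l = (1 :: real)" by (simp flip: power_mult_distrib)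
  finally show ?thesis by simp
qed

definition A :: "'a set" where
  "A = cstar_generated {Y j l |j l. j < n \<and> l < 2*n}"

lemma A_cstar_subalgebra: "cstar_subalgebra A"
  unfolding A_def by (rule cstar_subalgebra_cstar_generated)

lemma Y_in_A: "Y j l \<in> A"
proof -
  have "v ^ (2*j) = v ^ (2 * (j mod n))"
    using v_power_mod[of "2*j"] by (simp only: mod_mult_mult1)
  then have "Y j l = Y (j mod n) (l mod (2*n))" unfolding Y_mod by (simp only: Y_def)
  also have "\<dots> \<in> {Y j l |j l. j < n \<and> l < 2*n}" using n by force
  finally show ?thesis unfolding A_def by (rule subsetD[OF cstar_generated_subset])
qed

lemma A_subset_fixed: "A \<subseteq> {x. lam x = x}"
  unfolding A_def by (rule cstar_generated_least[OF _ cstar_subalgebra_fixed[OF lam]]) (auto simp: lam_Y)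

text \<open>
  Both \<open>Y 0 2\<close> and \<open>Y 1 0\<close> contain the isometry \<open>W 2\<close>, which cancels.  For \<open>n = 1\<close> the indices are
  outside the generating range and are read modulo \<open>2 * n\<close> and \<open>n\<close>.
\<close>

lemma v_square_in_A: "v * v \<in> A"
proof -
  have "Y 1 0 = W 2" using Y_eq[of 1 0] by (simp add: adj_one numeral_2_eq_2)
  then have "adj (Y 0 2) * Y 1 0 = v ^ 2 * (adj (W 2) * W 2)"
    by (simp add: Y_eq adj_mult adj_adj mult.assoc)
  also have "adj (W 2) * W 2 = 1" using cyclic_cuntzD(3)[OF W_cyc, of 2 2] by simp
  finally have "v * v = adj (Y 0 2) * Y 1 0" by (simp add: power2_eq_square)
  then show ?thesis using Y_in_A cstar_subalgebraD[OF A_cstar_subalgebra] by simp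
qed

lemma Ad_v_in_A:
  assumes "a \<in> A" shows "v * a * adj v \<in> A"
proof -
  have "A \<subseteq> Ad v -` A"
    unfolding A_def
  proof (rule cstar_generated_least)
    show "cstar_subalgebra (Ad v -` cstar_generated {Y j l |j l. j < n \<and> l < 2 * n})"
      by (intro cstar_subalgebra_vimage star_hom_Ad v_unitary cstar_subalgebra_cstar_generated)
    have "Ad v (Y j l) = Y j (Suc l)" for j l by (simp only: Y_def Ad_power)
    then show "{Y j l |j l. j < n \<and> l < 2 * n} \<subseteq> Ad v -` cstar_generated {Y j l |j l. j < n \<and> l < 2 * n}"
      using Y_in_A unfolding A_def by auto
  qed
  then show ?thesis using assms by (auto simp: Ad_def)
qed

text \<open>
  Conjugation by \<open>adj v\<close> differs from conjugation by \<open>v\<close> by the square \<open>v * v\<close>, which lies in \<open>A\<close>.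
\<close>

lemma Ad_adj_v_in_A:
  assumes "a \<in> A" shows "adj v * a * v \<in> A"
proof -
  have "adj v * a * v = adj (v * v) * (v * a * adj v) * (v * v)"
  proof -
    have "adj (v * v) * (v * a * adj v) * (v * v) = adj v * (adj v * v) * a * (adj v * v) * v"
      by (simp only: adj_mult mult.assoc)
    then show ?thesis by (simp add: v_unitary)
  qed
  then show ?thesis using assms v_square_in_A Ad_v_in_A cstar_subalgebraD[OF A_cstar_subalgebra] by simp
qed

text \<open>
  The *-subalgebra \<open>A + A * v\<close> contains the generators \<open>W l\<close>: those with even index lie in \<open>A\<close>,
  those with odd index in \<open>A * v\<close>.  It is closed because the components of \<open>x\<close> are the continuous
  functions \<open>E x\<close> and \<open>E' x\<close>.
\<close>

lemma A_plus_Av: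
  "\<exists>a\<in>A. \<exists>b\<in>A. x = a + b * v"
proof -
  note AD = cstar_subalgebraD[OF A_cstar_subalgebra]
  define B where "B = {a + b * v |a b. a \<in> A \<and> b \<in> A}"
  define E where "E = (\<lambda>x. (1/2) *\<^sub>R (x + lam x))"
  define E' where "E' = (\<lambda>x. (1/2) *\<^sub>R (x - lam x) * adj v)"
  have B_iff: "x \<in> B \<longleftrightarrow> E x \<in> A \<and> E' x \<in> A" for x
  proof
    assume "x \<in> B"
    then obtain a b where ab: "a \<in> A" "b \<in> A" "x = a + b * v" by (auto simp: B_def)
    then have "lam a = a" "lam b = b" using A_subset_fixed by auto
    then have "lam x = a - b * v"
      using ab(3) by (simp add: star_hom_wholeD[OF lam] lam_v)
    then have "x + lam x = 2 *\<^sub>R a" "x - lam x = 2 *\<^sub>R (b * v)"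
      using ab(3) by (simp_all add: scaleR_2)
    then have "E x = a" "E' x = b"
      by (simp_all add: E_def E'_def mult.assoc v_unitary)
    then show "E x \<in> A \<and> E' x \<in> A" using ab by simp
  next
    assume *: "E x \<in> A \<and> E' x \<in> A"
    have "E' x * v = (1/2) *\<^sub>R (x - lam x)" by (simp add: E'_def mult.assoc v_unitary)
    then have "E x + E' x * v = (1/2) *\<^sub>R (2 *\<^sub>R x)"
      by (simp only: E_def scaleR_add_right[symmetric] scaleR_2) simp
    then have "x = E x + E' x * v" by simp
    then show "x \<in> B" using * unfolding B_def by blast
  qed
  have "cstar_subalgebra B"
    unfolding cstar_subalgebra_def star_subalgebra_def
  proof (intro conjI ballI allI)
    show "0 \<in> B" using AD(1) unfolding B_def by force
    show "closed B"
    proof -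
      have "B = E -` A \<inter> E' -` A" by (auto simp: B_iff)
      moreover have "closed (E -` A)" "closed (E' -` A)"
        unfolding E_def E'_def
        by (intro closed_vimage AD continuous_intros star_hom_continuous_on[OF lam])+
      ultimately show ?thesis by (simp add: closed_Int)
    qed
    fix x y assume "x \<in> B" "y \<in> B"
    then obtain a b c d where ab: "a \<in> A" "b \<in> A" "x = a + b * v"
      and cd: "c \<in> A" "d \<in> A" "y = c + d * v" by (auto simp: B_def)
    have "x + y = (a + c) + (b + d) * v" using ab cd by (simp add: algebra_simps)
    then show "x + y \<in> B" using ab(1,2) cd(1,2) AD(2) unfolding B_def by blast
    \<comment> \<open>Moving \<open>v\<close> to the right past an element of \<open>A\<close> conjugates that element.\<close>
    have "x * y = (a * c + b * (v * d * adj v) * (v * v)) + (a * d + b * (v * c * adj v)) * v"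
    proof -
      have 1: "b * (v * d * adj v) * (v * v) = b * v * d * (adj v * v) * v"
        "b * (v * c * adj v) * v = b * v * c * (adj v * v)"
        by (simp_all only: mult.assoc)
      show ?thesis
        unfolding distrib_right[of _ _ v] 1 ab(3) cd(3) v_unitary mult_1_right
        by (simp only: distrib_left distrib_right mult.assoc add_ac)
    qed
    moreover have "a * c + b * (v * d * adj v) * (v * v) \<in> A" "a * d + b * (v * c * adj v) \<in> A"
      using ab(1,2) cd(1,2) by (auto intro!: AD(2,3) v_square_in_A Ad_v_in_A)
    ultimately show "x * y \<in> B" unfolding B_def by blast
  next
    fix x k assume "x \<in> B"
    then obtain a b where ab: "a \<in> A" "b \<in> A" "x = a + b * v" by (auto simp: B_def)
    then have "k *\<^sub>C x = k *\<^sub>C a + (k *\<^sub>C b) * v" by (simp add: scaleC_add_right mult_scaleC_left)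
    then show "k *\<^sub>C x \<in> B" using ab(1,2) AD(4) unfolding B_def by blast
  next
    fix x assume "x \<in> B"
    then obtain a b where ab: "a \<in> A" "b \<in> A" "x = a + b * v" by (auto simp: B_def)
    have "(adj v * adj b * v) * adj (v * v) * v = adj v * adj b * (v * adj v) * (adj v * v)"
      by (simp only: adj_mult mult.assoc)
    then have "adj x = adj a + (adj v * adj b * v) * adj (v * v) * v"
      using ab(3) by (simp add: v_unitary adj_add adj_mult)
    moreover have "(adj v * adj b * v) * adj (v * v) \<in> A"
      using ab(1,2) by (intro AD(3,5) v_square_in_A Ad_adj_v_in_A)
    ultimately show "adj x \<in> B" using AD(5)[OF ab(1)] unfolding B_def by blast
  qed
  have W_in_B: "W l \<in> B" for l
  proof (cases "even l")
    case True
    then obtain j where "l = 2 * j" by (elim evenE)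
    then have "W l = Y j 0 + 0 * v" by (simp add: Y_eq adj_one)
    then show ?thesis using Y_in_A AD(1) unfolding B_def by blast
  next
    case False
    then obtain j where "l = 2 * j + 1" by (elim oddE)
    then have "W l = 0 + Y j 1 * v" by (simp add: Y_eq mult.assoc v_unitary add.commute)
    then show ?thesis using Y_in_A AD(1) unfolding B_def by blast
  qed
  have "t q \<in> B" for q
  proof -
    have "t q = fourier (2*n) (cnj z) W q"
      using fourier_fourier_cnj[of "2*n" "cnj z" t q] z cyclic_cuntzD(2)[OF cyc]
      by (simp add: primitive_root_cnj)
    also have "\<dots> \<in> B"
      unfolding fourier_def[of _ "cnj z"]
      by (intro cstar_subalgebraD(4,7,8)[OF \<open>cstar_subalgebra B\<close>] W_in_B)
    finally show ?thesis .
  qed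
  then have "cstar_generated (range t) \<subseteq> B"
    using \<open>cstar_subalgebra B\<close> by (intro cstar_generated_least) auto
  then show ?thesis using gen unfolding B_def by blast
qed

lemma fixed_eq_A: "{x. lam x = x} = A"
proof
  show "{x. lam x = x} \<subseteq> A"
  proof safe
    fix x assume x: "lam x = x"
    obtain a b where ab: "a \<in> A" "b \<in> A" "x = a + b * v" using A_plus_Av by blast
    have "lam a = a" "lam b = b" using A_subset_fixed ab by auto
    then have "a - b * v = a + b * v"
      using x ab(3) by (simp add: star_hom_wholeD[OF lam] lam_v)
    then have "2 *\<^sub>R (b * v) = 0" by (simp add: scaleR_2 algebra_simps)
    then show "x \<in> A" using ab by simp
  qed
qed (rule A_subset_fixed)

section \<open>The algebra generated by one orbit\<close>

text \<open>
  In terms of the cyclic shift \<open>U = (\<Sum>i<2*n. t i * adj (t (i + 1)))\<close> and the block diagonal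
  element \<open>D = (\<Sum>i<2*n. t i * t i * adj (t i))\<close> this is \<open>U ^ k * D\<close>.  It is the model of \<open>W k\<close> up
  to a shift of \<open>k\<close>.
\<close>

definition F :: "nat \<Rightarrow> 'a" where
  "F k = (\<Sum>i<2*n. t i * t (i + k) * adj (t (i + k)))"

lemma t_mod_add: "t (i mod (2*n) + k) = t (i + k)"
  by (rule cyclic_cuntz_cong[OF cyc]) (simp add: mod_simps)

lemma F_shift: "F k = (\<Sum>i<2*n. t (i + l) * t (i + l + k) * adj (t (i + l + k)))"
  unfolding F_def
  by (subst sum_periodic_shift[of "\<lambda>i. t i * t (i + k) * adj (t (i + k))" "2*n" l, symmetric])
     (simp_all add: t_mod_add cyclic_cuntzD(2)[OF cyc])

lemma cyclic_cuntz_F: "cyclic_cuntz (2*n) F"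
  unfolding cyclic_cuntz_def
proof (intro conjI allI)
  note tD = cyclic_cuntzD[OF cyc]
  have proj: "t k * adj (t k) * (t l * adj (t l)) =
      (if k mod (2*n) = l mod (2*n) then t k * adj (t k) else 0)" for k l
  proof -
    have "t k * adj (t k) * (t l * adj (t l)) = t k * (adj (t k) * t l) * adj (t l)"
      by (simp only: mult.assoc)
    then show ?thesis using cyclic_cuntz_cong[OF cyc, of k l] by (simp add: tD)
  qed
  show "0 < 2 * n" using n by simp
  show "F (k mod (2*n)) = F k" for k
    unfolding F_def by (intro sum.cong refl) (metis t_mod_add add.commute)
  have adjF: "adj (F a) = (\<Sum>i<2*n. (t (i + a) * adj (t (i + a))) * adj (t (i + 0)))" for a
    by (simp add: F_def adj_sum adj_mult adj_adj mult.assoc)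
  have F': "F b = (\<Sum>i<2*n. t (i + 0) * (t (i + b) * adj (t (i + b))))" for b
    by (simp add: F_def mult.assoc)
  have "adj (F a) * F b =
     (\<Sum>i<2*n. (t (i + a) * adj (t (i + a))) * (t (i + b) * adj (t (i + b))))" for a b
    by (subst adjF, subst F', rule cyclic_cuntz_mult_sums[OF cyc])
  moreover have "(i + a) mod (2*n) = (i + b) mod (2*n) \<longleftrightarrow> a mod (2*n) = b mod (2*n)" for i a b :: nat
    by (auto simp: nat_mod_eq_iff algebra_simps)
  ultimately show "adj (F a) * F b = (if a mod (2*n) = b mod (2*n) then 1 else 0)" for a b
    by (simp add: proj cyclic_cuntz_sum_shift[OF cyc])
  have "F k * adj (F k) = (\<Sum>i<2*n. t i * (t (k + i) * adj (t (k + i))) * adj (t i))" for k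
  proof -
    have 1: "adj (F k) = (\<Sum>i<2*n. t (i + k) * (adj (t (i + k)) * adj (t i)))"
      by (simp add: F_def adj_sum adj_mult adj_adj mult.assoc)
    show ?thesis
      by (subst 1, subst F_def, subst cyclic_cuntz_mult_sums[OF cyc]) (simp add: mult.assoc add.commute)
  qed
  then have "(\<Sum>k<2*n. F k * adj (F k)) =
      (\<Sum>i<2*n. t i * (\<Sum>k<2*n. t (k + i) * adj (t (k + i))) * adj (t i))"
    by (simp add: sum_distrib_left sum_distrib_right) (rule sum.swap)
  then show "(\<Sum>k<2*n. F k * adj (F k)) = 1"
    by (simp add: cyclic_cuntz_sum_shift[OF cyc] tD)
qed

text \<open>
  The analogue for \<open>F\<close> of \<open>adj_v_power\<close> below; the right-hand side is the inverse of the \<open>l\<close>-th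
  power of the cyclic shift.
\<close>

lemma F_shift_product:
  "(\<Sum>k<2*n. F k * adj (F (k + l))) = (\<Sum>i<2*n. t (i + l) * adj (t i))"
proof -
  have "F k * adj (F (k + l)) =
     (\<Sum>i<2*n. t (i + l) * (t (k + (i + l)) * adj (t (k + (i + l)))) * adj (t i))" for k
  proof -
    have 1: "adj (F (k + l)) = (\<Sum>i<2*n. t (i + (k + l)) * (adj (t (i + (k + l))) * adj (t i)))"
      by (simp add: F_def adj_sum adj_mult adj_adj mult.assoc)
    have 2: "F k = (\<Sum>i<2*n. (t (i + l) * t (i + (k + l))) * adj (t (i + (k + l))))"
      using F_shift[of k l] by (simp add: ac_simps)
    show ?thesis
      by (subst 1, subst 2, subst cyclic_cuntz_mult_sums[OF cyc]) (simp add: mult.assoc ac_simps)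
  qed
  then have "(\<Sum>k<2*n. F k * adj (F (k + l))) =
     (\<Sum>i<2*n. t (i + l) * (\<Sum>k<2*n. t (k + (i + l)) * adj (t (k + (i + l)))) * adj (t i))"
    by (simp add: sum_distrib_left sum_distrib_right) (rule sum.swap)
  then show ?thesis by (simp add: cyclic_cuntz_sum_shift[OF cyc])
qed

text \<open>
  Multiplication by \<open>v\<close> shifts the family \<open>W\<close>.
\<close>

lemma adj_v_power: "adj (v ^ l) = (\<Sum>k<2*n. W k * adj (W (k + l)))"
proof -
  have "W k * adj (W (k + l)) = W k * adj (W k) * adj (v ^ l)" for k
  proof -
    have "W (k + l) = v ^ l * W k" by (simp add: vW add.commute)
    then show ?thesis by (simp add: adj_mult mult.assoc)
  qed
  then show ?thesis
    using cyclic_cuntzD(4)[OF W_cyc] by (simp flip: sum_distrib_right)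
qed

text \<open>
  The map \<open>\<psi>\<close> transports \<open>W\<close> to a shift of \<open>F\<close>, and thereby \<open>Y j l\<close> to a block diagonal element
  whose block at \<open>0\<close> is \<open>t l\<close>.  So compressing \<open>\<psi> (\<phi> x)\<close> to that block gives back \<open>x\<close>, and \<open>\<phi>\<close> is
  isometric; its range is then closed and equals the algebra generated by the \<open>Y j l\<close>.
\<close>

lemma star_isomorphic_generated_Y:
  assumes j: "j < n"
  shows "star_isomorphic (cstar_on (cstar_generated {Y j l |l. l < 2*n})) (cstar_whole :: 'a cstar_structure)"
proof -
  let ?C = "cstar_generated {Y j l |l. l < 2*n}"
  obtain \<phi> where \<phi>: "star_hom cstar_whole cstar_whole \<phi>" "\<And>l. \<phi> (t l) = Y j l"
    using univ[OF cyclic_cuntz_Y[of j]] by blast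
  \<comment> \<open>The shift by \<open>e\<close>, which is \<open>- 2 * j\<close> modulo \<open>2 * n\<close>, cancels the factor \<open>v ^ (2 * j)\<close>
    in \<open>Y j l\<close>.  The inverse Fourier transform turns a prescribed image of \<open>W\<close> into one of \<open>t\<close>.\<close>
  define e where "e = 2 * (n - j)"
  have e: "l + 2 * j + e = l + 2 * n" for l using j by (simp add: e_def)
  define F' where "F' = (\<lambda>k. F (k + e))"
  have F': "cyclic_cuntz (2*n) F'"
    unfolding F'_def by (rule cyclic_cuntz_shift[OF cyclic_cuntz_F])
  have "cyclic_cuntz (2*n) (fourier (2*n) (cnj z) F')"
    by (rule cyclic_cuntz_fourier[OF _ F']) (simp add: primitive_root_cnj z)
  then obtain \<psi> where \<psi>: "star_hom cstar_whole cstar_whole \<psi>" "\<And>q. \<psi> (t q) = fourier (2*n) (cnj z) F' q"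
    using univ by blast
  have \<psi>W: "\<psi> (W k) = F' k" for k
  proof -
    have "\<psi> (W k) = fourier (2*n) z (fourier (2*n) (cnj z) F') k"
      by (simp add: fourier_def[of _ z] star_hom_linear[OF \<psi>(1)] star_hom_wholeD[OF \<psi>(1)] \<psi>(2))
    then show ?thesis using fourier_fourier_cnj[OF z, of F'] cyclic_cuntzD(2)[OF F'] by simp
  qed
  have \<psi>Y: "\<psi> (Y j l) = (\<Sum>i<2*n. t i * t (i + l) * adj (t i))" for l
  proof -
    have "F' (l + 2*j) = F l"
      unfolding F'_def by (rule cyclic_cuntz_cong[OF cyclic_cuntz_F]) (simp add: e)
    moreover have "\<psi> (adj (v ^ l)) = (\<Sum>k<2*n. F' k * adj (F' (k + l)))"
      unfolding adj_v_power by (simp add: star_hom_linear[OF \<psi>(1)] star_hom_wholeD[OF \<psi>(1)] \<psi>W)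
    ultimately have "\<psi> (Y j l) = F l * (\<Sum>k<2*n. F' k * adj (F' (k + l)))"
      by (simp only: Y_eq star_hom_wholeD(2)[OF \<psi>(1)] \<psi>W)
    also have "(\<Sum>k<2*n. F' k * adj (F' (k + l))) = (\<Sum>k<2*n. F k * adj (F (k + l)))"
    proof -
      have "F (k mod (2*n)) * adj (F (k mod (2*n) + l)) = F k * adj (F (k + l))" for k
        using cyclic_cuntz_cong[OF cyclic_cuntz_F, of "k mod (2*n) + l" "k + l"]
          cyclic_cuntzD(2)[OF cyclic_cuntz_F] by (simp add: mod_simps)
      from sum_periodic_shift[of "\<lambda>k. F k * adj (F (k + l))", OF this, of e] show ?thesis by (simp add: F'_def ac_simps)
    qed
    also have "\<dots> = (\<Sum>i<2*n. t (i + l) * adj (t i))" by (rule F_shift_product)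
    finally show ?thesis unfolding F_def cyclic_cuntz_mult_sums[OF cyc] .
  qed
  have isom: "norm x \<le> norm (\<phi> x)" for x
  proof -
    have \<theta>: "star_hom cstar_whole cstar_whole (\<lambda>x. \<psi> (\<phi> x))"
      by (rule star_hom_wholeI) (simp_all add: star_hom_wholeD[OF \<phi>(1)] star_hom_wholeD[OF \<psi>(1)])
    have t0: "adj (t 0) * t 0 = 1" using cyclic_cuntzD(3)[OF cyc, of 0 0] by simp
    have D: "(\<Sum>i<2*n. t i * t (i + l) * adj (t i)) * t 0 = t 0 * t l"
      "adj (t 0) * (\<Sum>i<2*n. t i * t (i + l) * adj (t i)) = t l * adj (t 0)" for l
    proof -
      have "t i * t (i + l) * adj (t i) * t 0 = (if i = 0 then t 0 * t l else 0)" if "i < 2*n" for i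
        using cyclic_cuntzD(3)[OF cyc, of i 0] that by (simp add: mult.assoc)
      then show "(\<Sum>i<2*n. t i * t (i + l) * adj (t i)) * t 0 = t 0 * t l"
        using n by (simp add: sum_distrib_right)
      have "adj (t 0) * (t i * t (i + l) * adj (t i)) = (if i = 0 then t l * adj (t 0) else 0)"
        if "i < 2*n" for i
        using cyclic_cuntzD(3)[OF cyc, of 0 i] that by (simp flip: mult.assoc)
      then show "adj (t 0) * (\<Sum>i<2*n. t i * t (i + l) * adj (t i)) = t l * adj (t 0)"
        using n by (simp add: sum_distrib_left)
    qed
    have "\<psi> (\<phi> x) * t 0 = t 0 * x"
      by (rule star_hom_intertwined_by_isometry[OF \<theta> gen t0]) (auto simp: \<phi>(2) \<psi>Y D)
    then have "x = adj (t 0) * (\<psi> (\<phi> x) * t 0)" using t0 by (simp flip: mult.assoc)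
    then have "norm x \<le> norm (adj (t 0)) * norm (\<psi> (\<phi> x) * t 0)"
      using norm_mult_ineq[of "adj (t 0)" "\<psi> (\<phi> x) * t 0"] by simp
    also have "norm (t 0) \<le> 1" by (rule norm_le_1_if_cstar) (simp add: t0)
    then have "norm (adj (t 0)) * norm (\<psi> (\<phi> x) * t 0) \<le> 1 * (norm (\<psi> (\<phi> x)) * 1)"
      by (intro mult_mono order_trans[OF norm_mult_ineq] order_refl) (auto simp: norm_adj)
    also have "\<dots> \<le> norm (\<phi> x)" by (simp add: star_hom_contractive[OF \<psi>(1)])
    finally show ?thesis .
  qed
  have range: "range \<phi> = ?C"
  proof
    have "cstar_generated (range t) \<subseteq> \<phi> -` ?C"
    proof (rule cstar_generated_least)
      show "cstar_subalgebra (\<phi> -` ?C)"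
        by (intro cstar_subalgebra_vimage \<phi> cstar_subalgebra_cstar_generated)
      have "l mod (2*n) < 2*n" for l using n by simp
      then have "Y j l \<in> {Y j l |l. l < 2*n}" for l
        using Y_mod[of j l, symmetric] by blast
      then have "Y j l \<in> ?C" for l by (rule subsetD[OF cstar_generated_subset])
      then show "range t \<subseteq> \<phi> -` ?C" by (auto simp: \<phi>(2))
    qed
    then show "range \<phi> \<subseteq> ?C" using gen by auto
    show "?C \<subseteq> range \<phi>"
      by (rule cstar_generated_least[OF _ cstar_subalgebra_range[OF \<phi>(1) isom]])
         (auto simp flip: \<phi>(2))
  qed
  have inj: "inj \<phi>"
  proof (rule injI)
    fix x y assume "\<phi> x = \<phi> y"
    then have "norm (x - y) \<le> 0" using isom[of "x - y"] by (simp add: star_hom_linear[OF \<phi>(1)])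
    then show "x = y" by simp
  qed
  have "bij_betw (inv_into UNIV \<phi>) ?C UNIV"
    using inj range by (intro bij_betw_inv_into) (simp add: bij_betw_def)
  moreover have "star_hom (cstar_on ?C) cstar_whole (inv_into UNIV \<phi>)"
    unfolding star_hom_def range[symmetric] by (auto simp: inj simp flip: star_hom_wholeD[OF \<phi>(1)])
  ultimately have "star_iso (cstar_on ?C) cstar_whole (inv_into UNIV \<phi>)"
    by (simp add: star_iso_def)
  then show ?thesis unfolding star_isomorphic_def by blast
qed

end

section \<open>From the given generators to the cyclic ones\<close>

text \<open>
  The eigenvalue of \<open>v_tilde\<close> on the range of \<open>S k\<close> is the power of the root of unity with exponent
  \<open>reflect n k\<close>.  As a permutation of \<open>{1..2*n}\<close> it is an involution, so it also gives the
  generator that belongs to a given exponent.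
\<close>

definition reflect :: "nat \<Rightarrow> nat \<Rightarrow> nat" where
  "reflect n k = (if k \<le> n then k else 3 * n + 1 - k)"

text \<open>
  The representative in \<open>{1..m}\<close>, as the generators are numbered from \<open>1\<close>.
\<close>

definition residue :: "nat \<Rightarrow> nat \<Rightarrow> nat" where
  "residue m q = (if q mod m = 0 then m else q mod m)"

lemma residue_props:
  assumes "m > 0"
  shows "residue m q \<in> {1..m}" "residue m q mod m = q mod m" "residue m (q mod m) = residue m q"
    "k \<in> {1..m} \<Longrightarrow> residue m k = k"
    "residue m a = residue m b \<longleftrightarrow> a mod m = b mod m"
proof -
  have "x mod m < m" "x mod m \<noteq> m" "m \<noteq> x mod m" for x
    using mod_less_divisor[OF assms, of x] by simp_all
  note less = this
  show "residue m q \<in> {1..m}" "residue m q mod m = q mod m" "residue m (q mod m) = residue m q"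
    "residue m a = residue m b \<longleftrightarrow> a mod m = b mod m"
    using assms by (auto simp: residue_def less less_imp_le)
  show "residue m k = k" if "k \<in> {1..m}" for k
    using that by (auto simp: residue_def le_eq_less_or_eq)
qed

lemma reflect_props:
  assumes "k \<in> {1..2*n}"
  shows "reflect n k \<in> {1..2*n}" "reflect n (reflect n k) = k"
  using assms by (auto simp: reflect_def)

lemma sum_periodic_from_1:
  fixes f :: "nat \<Rightarrow> 'b::ab_group_add"
  assumes "\<And>k. f (k mod m) = f k"
  shows "(\<Sum>k=1..m. f k) = (\<Sum>k<m. f k)"
  using sum_periodic_shift[of f, OF assms, of 1] sum.atLeast1_atMost_eq[of f m] by simp

lemma sum_reflect: "(\<Sum>k=1..2*n. f (reflect n k)) = (\<Sum>k=1..2*n. f k)"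
  by (rule sum.reindex_bij_witness[of _ "reflect n" "reflect n"]) (use reflect_props in \<open>blast | simp\<close>)+

text \<open>
  The passage from \<open>S\<close> to \<open>t\<close> lists the generators by the eigenvalues of \<open>v_tilde\<close>.  The reflection
  of the upper half of the indices turns \<open>k \<mapsto> 2 * n - k + 1\<close> into the rotation by \<open>n\<close>.
\<close>

lemma exchange_setting_of_cuntz_algebra:
  fixes S :: "nat \<Rightarrow> 'a::cstar_algebra"
  assumes n: "n \<ge> 1" and S: "cuntz_algebra (2*n) S" and lam: "exchange_automorphism n S lam"
  defines "t \<equiv> (\<lambda>q. S (reflect n (residue (2*n) q)))"
    and "z \<equiv> exp (complex_of_real (2 * pi) * \<i> / (2 * of_nat n))"
  shows "exchange_setting n t lam z" "T_elem n S = fourier (2*n) z t 0" "v_tilde n S = clock (2*n) z t"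
proof -
  have m: "2 * n > 0" using n by simp
  note res = residue_props[OF m]
  have iso: "cuntz_isometries cstar_whole (2*n) S" using S by (simp add: cuntz_algebra_def)
  have t_per: "t (q mod (2*n)) = t q" for q by (simp add: t_def res(3))
  have t_refl: "t (reflect n k) = S k" if "k \<in> {1..2*n}" for k
    by (simp only: t_def res(4)[OF reflect_props(1)[OF that]] reflect_props(2)[OF that])
  have t_S: "t k = S (reflect n k)" if "k \<in> {1..2*n}" for k
    by (simp only: t_def res(4)[OF that])
  have sum_t: "(\<Sum>q<2*n. f (t q)) = (\<Sum>k=1..2*n. f (S k))" for f :: "'a \<Rightarrow> 'a"
  proof -
    have "(\<Sum>q<2*n. f (t q)) = (\<Sum>q=1..2*n. f (t q))"
      by (rule sum_periodic_from_1[symmetric]) (simp add: t_per)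
    also have "\<dots> = (\<Sum>k=1..2*n. f (S (reflect n k)))" by (intro sum.cong) (auto simp: t_S)
    also have "\<dots> = (\<Sum>k=1..2*n. f (S k))" by (rule sum_reflect)
    finally show ?thesis .
  qed
  have z: "primitive_root (2*n) z"
    unfolding primitive_root_def
  proof (intro conjI allI m)
    fix d
    have "z ^ d = exp (2 * of_real pi * \<i> * of_nat d / of_nat (2*n))"
      by (simp add: z_def flip: exp_of_nat_mult) (simp add: ac_simps)
    also have "\<dots> = 1 \<longleftrightarrow> 2 * n dvd d"
      using complex_root_unity_eq_1[of "2*n" d] n by simp
    finally show "z ^ d = 1 \<longleftrightarrow> 2 * n dvd d" .
  qed
  show "T_elem n S = fourier (2*n) z t 0"
    using sum_t[of "\<lambda>x. x"] by (simp add: T_elem_def fourier_def scaleC_one)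
  show "v_tilde n S = clock (2*n) z t"
  proof -
    have zp: "z ^ k = exp (2 * pi * k * \<i> / (2 * n))" for k :: nat
      by (simp add: z_def flip: exp_of_nat_mult) (simp add: ac_simps)
    let ?f = "\<lambda>k. z ^ k *\<^sub>C (t k * adj (t k))"
    have "clock (2*n) z t = (\<Sum>k=1..2*n. ?f k)"
      unfolding clock_def
      by (rule sum_periodic_from_1[symmetric]) (simp add: t_per primitive_root_power_mod[OF z])
    also have "{1..2*n} = {1..n} \<union> {1+n..n+n}" by auto
    also have "sum ?f ({1..n} \<union> {1+n..n+n}) = sum ?f {1..n} + sum ?f {1+n..n+n}"
      by (rule sum.union_disjoint) auto
    also have "sum ?f {1+n..n+n} = (\<Sum>k=1..n. ?f (k + n))" by (rule sum.shift_bounds_cl_nat_ivl)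
    also have "sum ?f {1..n} = (\<Sum>k=1..n. z ^ k *\<^sub>C (S k * adj (S k)))"
      by (intro sum.cong refl) (auto simp: t_S reflect_def)
    also have "(\<Sum>k=1..n. ?f (k + n)) =
      (\<Sum>k=1..n. z ^ (k + n) *\<^sub>C (S (2*n - k + 1) * adj (S (2*n - k + 1))))"
    proof (intro sum.cong refl)
      fix k assume "k \<in> {1..n}"
      then have "t (k + n) = S (2*n - k + 1)"
        by (subst t_S) (auto simp: reflect_def intro!: arg_cong[where f = S])
      then show "?f (k + n) = z ^ (k + n) *\<^sub>C (S (2*n - k + 1) * adj (S (2*n - k + 1)))" by simp
    qed
    finally show ?thesis by (simp only: v_tilde_def zp of_nat_add of_nat_mult of_nat_numeral)
  qed
  show "exchange_setting n t lam z"
  proof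
    show "1 \<le> n" "primitive_root (2*n) z" by fact+
    show "cyclic_cuntz (2*n) t"
      unfolding cyclic_cuntz_def
    proof (intro conjI allI m t_per)
      fix a b
      let ?i = "reflect n (residue (2*n) a)" and ?j = "reflect n (residue (2*n) b)"
      have ij: "?i \<in> {1..2*n}" "?j \<in> {1..2*n}" by (intro reflect_props res)+
      have "?i = ?j \<longleftrightarrow> a mod (2*n) = b mod (2*n)" using reflect_props(2) res(1,5) by metis
      then show "adj (t a) * t b = (if a mod (2*n) = b mod (2*n) then 1 else 0)"
        using ij iso cuntz_isometries_orthogonal[OF iso ij]
        by (auto simp: t_def cuntz_isometries_cstar_whole)
      show "(\<Sum>k<2*n. t k * adj (t k)) = 1"
        using iso sum_t[of "\<lambda>x. x * adj x"] by (simp add: cuntz_isometries_cstar_whole)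
    qed
    have "S ` {1..2*n} \<subseteq> range t" using t_refl by (metis image_subsetI rangeI)
    then show "cstar_generated (range t) = UNIV"
      using S cstar_generated_least[OF _ cstar_subalgebra_cstar_generated, of "S ` {1..2*n}" "range t"]
        cstar_generated_subset[of "range t"] by (auto simp: cuntz_algebra_def)
    show "\<exists>\<phi>. star_hom cstar_whole cstar_whole \<phi> \<and> (\<forall>q. \<phi> (t q) = R q)"
      if R: "cyclic_cuntz (2*n) R" for R :: "nat \<Rightarrow> 'a"
    proof -
      have per: "R (q mod (2*n)) * adj (R (q mod (2*n))) = R q * adj (R q)" for q
        by (simp add: cyclic_cuntzD(2)[OF R])
      have "cuntz_isometries cstar_whole (2*n) (\<lambda>k. R (reflect n k))"
        using sum_reflect[of "\<lambda>k. R k * adj (R k)" n] sum_periodic_from_1[of "\<lambda>k. R k * adj (R k)", OF per] cyclic_cuntzD(3,4)[OF R]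
        by (simp add: cuntz_isometries_cstar_whole)
      then obtain \<phi> where \<phi>: "star_hom cstar_whole cstar_whole \<phi>" "\<forall>k\<in>{1..2*n}. \<phi> (S k) = R (reflect n k)"
        using S unital_cstar_algebra_cstar_whole unfolding cuntz_algebra_def by blast
      have "\<phi> (t q) = R q" for q
      proof -
        have "\<phi> (t q) = R (reflect n (reflect n (residue (2*n) q)))"
          unfolding t_def using \<phi>(2) reflect_props(1) res(1) by blast
        also have "\<dots> = R q"
          using reflect_props(2)[OF res(1)] cyclic_cuntz_cong[OF R res(2)] by simp
        finally show ?thesis .
      qed
      then show ?thesis using \<phi>(1) by blast
    qed
    show "star_hom cstar_whole cstar_whole lam"
      using lam by (simp add: exchange_automorphism_def star_iso_def)
    fix q
    let ?k = "residue (2*n) q"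
    have k: "?k \<in> {1..2*n}" by (rule res)
    have eq: "t (q + n) = t (?k + n)"
      using t_per[of "q + n"] t_per[of "?k + n"] res(2)[of q] by (metis mod_add_left_eq)
    have "lam (t q) = S (2*n - reflect n ?k + 1)"
      using lam reflect_props(1)[OF k] by (simp add: t_def exchange_automorphism_def)
    also have "\<dots> = t (?k + n)"
    proof (cases "?k \<le> n")
      case True
      then show ?thesis using k
        by (subst t_S) (auto simp: reflect_def intro!: arg_cong[where f = S])
    next
      case False
      then have "?k + n = ?k - n + 2*n" by simp
      then have "(?k + n) mod (2*n) = (?k - n) mod (2*n)" by (simp only: mod_add_self2)
      then have "t (?k + n) = t (?k - n)" using t_per by metis
      also have "\<dots> = S (?k - n)" using False k by (subst t_S) (auto simp: reflect_def)
      finally show ?thesis using False k by (auto simp: reflect_def intro!: arg_cong[where f = S])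
    qed
    finally show "lam (t q) = t (q + n)" using eq by simp
  qed
qed

theorem theorem4p1:
  fixes n :: nat and S :: "nat \<Rightarrow> 'a::cstar_algebra" and lam :: "'a \<Rightarrow> 'a"
  assumes "n \<ge> 1"
    and "cuntz_algebra (2*n) S"
    and "exchange_automorphism n S lam"
  shows "{x. lam x = x} = cstar_generated {y_elem n S j l |j l. j < n \<and> l < 2*n} \<and>
         (\<forall>j<n. star_isomorphic
                  (cstar_on (cstar_generated {y_elem n S j l |l. l < 2*n}))
                  (cstar_whole :: 'a cstar_structure))"
proof -
  let ?t = "\<lambda>q. S (reflect n (residue (2*n) q))"
  let ?z = "exp (complex_of_real (2 * pi) * \<i> / (2 * of_nat n))"
  note setting = exchange_setting_of_cuntz_algebra[OF assms]
  interpret exchange_setting n ?t lam ?z by (rule setting)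
  let ?r = "real (2*n) powr (-1/2)"
  have r: "?r \<noteq> 0" using assms(1) by simp
  have y: "y_elem n S j l = ?r *\<^sub>R Y j l" for j l
    by (simp only: y_elem_def setting(2,3) Y_def)
  have "{y_elem n S j l |j l. j < n \<and> l < 2*n} = (\<lambda>x. ?r *\<^sub>R x) ` {Y j l |j l. j < n \<and> l < 2*n}"
    unfolding y by blast
  moreover have "{y_elem n S j l |l. l < 2*n} = (\<lambda>x. ?r *\<^sub>R x) ` {Y j l |l. l < 2*n}" for j
    unfolding y by blast
  ultimately show ?thesis
    using fixed_eq_A star_isomorphic_generated_Y by (simp only: cstar_generated_scale[OF r] A_def) blast
qed

end
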